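(* Let $\mathfrak{b}(z,w)=(1-z\overline{w})^{-2}$ denote the Bergman kernel on $\mathbb{D}=\{z\in\mathbb{C}:|z|<1\}$ and fix $0<r\le1$. If $\ell$ is a regular holomorphic kernel on $r\mathbb{D}$ such that $(\mathfrak{b},\ell)$ is a complete Pick pair on $r\mathbb{D}$, then $$r\le\frac{1}{\sqrt2}.$$
   Context: A kernel on a non-empty set $X$ is a function $k:X\times X\to\mathbb{C}$ such that $[k(z_i,z_j)]_{i,j=1}^n$ is positive semi-definite for all finite choices of points; $\mathcal{H}_k$ is the reproducing kernel Hilbert space and $k_w=k(\cdot,w)$ are the kernel functions. $\mathrm{Mult}(\mathcal{H}_k\otimes\mathbb{C}^N,\mathcal{H}_\ell\otimes\mathbb{C}^N)$ is the set of $\Phi:X\to\mathbb{M}_N$ (complex $N\times N$ matrices) with $\Phi f\in\mathcal{H}_\ell\otimes\mathbb{C}^N$ for all $f\in\mathcal{H}_k\otimes\mathbb{C}^N$, normed by the operator norm of $f\mapsto\Phi f$. $(k,\ell)$ is a complete Pick pair on $X$ if for all $n,N\ge1$, all $z_1,\dots,z_n\in X$ and all $W_1,\dots,W_n\in\mathbb{M}_N$ with $[\ell(z_i,z_j)I_{N\times N}-k(z_i,z_j)W_iW_j^*]_{i,j=1}^n$ positive semi-definite, there is $\Phi\in\mathrm{Mult}(\mathcal{H}_k\otimes\mathbb{C}^N,\mathcal{H}_\ell\otimes\mathbb{C}^N)$ of norm at most one with $\Phi(z_i)=W_i$ for all $i$. A holomorphic kernel is a kernel holomorphic in $z$ and conjugate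 holomorphic in $w$. A holomorphic kernel $\ell(z,w)=\sum_{i,j\ge0}\ell_{ij}z^i\overline{w}^j$ defined on an open neighborhood of the origin is regular if (i) every collection of kernel functions $\{\ell_{z_1},\dots,\ell_{z_n}\}$ with $z_1,\dots,z_n$ distinct and sufficiently close to $0$ is linearly independent and (ii) all (finite) principal determinants of the coefficient matrix $(\ell_{ij})_{i,j\ge0}$ are non-zero. *)

theory Defs
  imports
    "HOL-Analysis.Analysis"
    "Jordan_Normal_Form.Schur_Decomposition"
begin

unbundle no vec_syntax
unbundle no inner_syntax

section \<open>Positive semi-definite matrices and kernels\<close>

text \<open>In the order on \<^typ>\<open>complex\<close>, \<open>0 \<le> c\<close> means that \<open>c\<close> is real and non-negative.\<close>

definition psd_mat :: "complex mat \<Rightarrow> bool" where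
  "psd_mat A \<longleftrightarrow> square_mat A \<and> (\<forall>v \<in> carrier_vec (dim_row A). 0 \<le> (A *\<^sub>v v) \<bullet>c v)"

definition kernel_on :: "'x set \<Rightarrow> ('x \<Rightarrow> 'x \<Rightarrow> complex) \<Rightarrow> bool" where
  "kernel_on X k \<longleftrightarrow> X \<noteq> {} \<and>
     (\<forall>n. \<forall>z :: nat \<Rightarrow> 'x. (\<forall>i<n. z i \<in> X) \<longrightarrow> psd_mat (mat n n (\<lambda>(i, j). k (z i) (z j))))"


section \<open>Reproducing kernel Hilbert spaces\<close>

text \<open>A function on \<open>X\<close> is represented by its extension by zero to the whole type.\<close>

definition restr :: "'x set \<Rightarrow> ('x \<Rightarrow> 'a::zero) \<Rightarrow> 'x \<Rightarrow> 'a" where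
  "restr X f = (\<lambda>z. if z \<in> X then f z else 0)"

record 'x function_space =
  fns :: "('x \<Rightarrow> complex) set"
  ip :: "('x \<Rightarrow> complex) \<Rightarrow> ('x \<Rightarrow> complex) \<Rightarrow> complex"

definition fnorm :: "'x function_space \<Rightarrow> ('x \<Rightarrow> complex) \<Rightarrow> real" where
  "fnorm H f = sqrt (Re (ip H f f))"

definition hilbert_function_space :: "'x set \<Rightarrow> 'x function_space \<Rightarrow> bool" where
  "hilbert_function_space X H \<longleftrightarrow>
     (\<forall>f \<in> fns H. \<forall>z. z \<notin> X \<longrightarrow> f z = 0) \<and>
     (\<lambda>z. 0) \<in> fns H \<and>
     (\<forall>f \<in> fns H. \<forall>g \<in> fns H. (\<lambda>z. f z + g z) \<in> fns H) \<and>
     (\<forall>c. \<forall>f \<in> fns H. (\<lambda>z. c * f z) \<in> fns H) \<and>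
     (\<forall>f \<in> fns H. \<forall>g \<in> fns H. \<forall>h \<in> fns H. ip H (\<lambda>z. f z + g z) h = ip H f h + ip H g h) \<and>
     (\<forall>c. \<forall>f \<in> fns H. \<forall>h \<in> fns H. ip H (\<lambda>z. c * f z) h = c * ip H f h) \<and>
     (\<forall>f \<in> fns H. \<forall>g \<in> fns H. ip H g f = cnj (ip H f g)) \<and>
     (\<forall>f \<in> fns H. 0 \<le> ip H f f \<and> (ip H f f = 0 \<longrightarrow> f = (\<lambda>z. 0))) \<and>
     (\<forall>F :: nat \<Rightarrow> 'x \<Rightarrow> complex. (\<forall>n. F n \<in> fns H) \<longrightarrow>
        (\<forall>e>0. \<exists>M. \<forall>m\<ge>M. \<forall>n\<ge>M. fnorm H (\<lambda>z. F m z - F n z) < e) \<longrightarrow>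
        (\<exists>f \<in> fns H. (\<lambda>n. fnorm H (\<lambda>z. F n z - f z)) \<longlonglongrightarrow> 0))"

definition is_rkhs :: "'x set \<Rightarrow> ('x \<Rightarrow> 'x \<Rightarrow> complex) \<Rightarrow> 'x function_space \<Rightarrow> bool" where
  "is_rkhs X k H \<longleftrightarrow> hilbert_function_space X H \<and>
     (\<forall>w \<in> X. restr X (\<lambda>z. k z w) \<in> fns H \<and>
        (\<forall>f \<in> fns H. ip H f (restr X (\<lambda>z. k z w)) = f w))"


section \<open>Multipliers and complete Pick pairs\<close>

text \<open>Elements of the Hilbert space tensor product of \<open>H\<close> with \<open>\<complex>\<^sup>N\<close> are the functions with
  values in \<open>\<complex>\<^sup>N\<close> all of whose coordinate functions lie in \<open>H\<close>.\<close>

definition tensor_fns :: "'x function_space \<Rightarrow> nat \<Rightarrow> ('x \<Rightarrow> complex vec) set" where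
  "tensor_fns H N = {f. (\<forall>z. f z \<in> carrier_vec N) \<and> (\<forall>p<N. (\<lambda>z. f z $ p) \<in> fns H)}"

definition tensor_norm :: "'x function_space \<Rightarrow> nat \<Rightarrow> ('x \<Rightarrow> complex vec) \<Rightarrow> real" where
  "tensor_norm H N f = sqrt (\<Sum>p<N. (fnorm H (\<lambda>z. f z $ p))\<^sup>2)"

definition mult_op :: "'x set \<Rightarrow> nat \<Rightarrow> ('x \<Rightarrow> complex mat) \<Rightarrow> ('x \<Rightarrow> complex vec) \<Rightarrow> 'x \<Rightarrow> complex vec"
  where "mult_op X N \<Phi> f = (\<lambda>z. if z \<in> X then \<Phi> z *\<^sub>v f z else 0\<^sub>v N)"

definition Mult :: "'x set \<Rightarrow> 'x function_space \<Rightarrow> 'x function_space \<Rightarrow> nat \<Rightarrow> ('x \<Rightarrow> complex mat) set"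
  where "Mult X H K N =
    {\<Phi>. (\<forall>z \<in> X. \<Phi> z \<in> carrier_mat N N) \<and> (\<forall>f \<in> tensor_fns H N. mult_op X N \<Phi> f \<in> tensor_fns K N)}"

definition mult_norm ::
  "'x set \<Rightarrow> 'x function_space \<Rightarrow> 'x function_space \<Rightarrow> nat \<Rightarrow> ('x \<Rightarrow> complex mat) \<Rightarrow> ennreal" where
  "mult_norm X H K N \<Phi> =
     (SUP f \<in> {f \<in> tensor_fns H N. tensor_norm H N f \<le> 1}. ennreal (tensor_norm K N (mult_op X N \<Phi> f)))"

text \<open>The \<open>nN \<times> nN\<close> matrix whose \<open>(i, j)\<close> block is \<open>\<ell>(z\<^sub>i, z\<^sub>j) I - k(z\<^sub>i, z\<^sub>j) W\<^sub>i W\<^sub>j\<^sup>*\<close>.\<close>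

definition pick_matrix :: "('x \<Rightarrow> 'x \<Rightarrow> complex) \<Rightarrow> ('x \<Rightarrow> 'x \<Rightarrow> complex) \<Rightarrow> nat \<Rightarrow> nat \<Rightarrow>
    (nat \<Rightarrow> 'x) \<Rightarrow> (nat \<Rightarrow> complex mat) \<Rightarrow> complex mat" where
  "pick_matrix k l n N z W = mat (n * N) (n * N) (\<lambda>(a, b).
     let i = a div N; j = b div N in
     (l (z i) (z j) \<cdot>\<^sub>m 1\<^sub>m N - k (z i) (z j) \<cdot>\<^sub>m (W i * mat_adjoint (W j))) $$ (a mod N, b mod N))"

text \<open>The spaces \<open>H\<close> and \<open>K\<close> below are determined by \<open>k\<close> and \<open>l\<close>: for every kernel there is,
  by the Moore--Aronszajn theorem, exactly one reproducing kernel Hilbert space.\<close>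

definition complete_Pick_pair ::
  "'x set \<Rightarrow> ('x \<Rightarrow> 'x \<Rightarrow> complex) \<Rightarrow> ('x \<Rightarrow> 'x \<Rightarrow> complex) \<Rightarrow> bool" where
  "complete_Pick_pair X k l \<longleftrightarrow> kernel_on X k \<and> kernel_on X l \<and>
     (\<exists>H K. is_rkhs X k H \<and> is_rkhs X l K \<and>
       (\<forall>n\<ge>1. \<forall>N\<ge>1. \<forall>z W.
          (\<forall>i<n. z i \<in> X \<and> W i \<in> carrier_mat N N) \<longrightarrow> psd_mat (pick_matrix k l n N z W) \<longrightarrow>
          (\<exists>\<Phi> \<in> Mult X H K N. mult_norm X H K N \<Phi> \<le> 1 \<and> (\<forall>i<n. \<Phi> (z i) = W i))))"


section \<open>Holomorphic kernels\<close>

definition holomorphic_kernel :: "complex set \<Rightarrow> (complex \<Rightarrow> complex \<Rightarrow> complex) \<Rightarrow> bool" where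
  "holomorphic_kernel U l \<longleftrightarrow> kernel_on U l \<and>
     (\<forall>w \<in> U. (\<lambda>z. l z w) holomorphic_on U) \<and>
     (\<forall>z \<in> U. (\<lambda>w. cnj (l z w)) holomorphic_on U)"

definition has_coefficients ::
  "(complex \<Rightarrow> complex \<Rightarrow> complex) \<Rightarrow> (nat \<Rightarrow> nat \<Rightarrow> complex) \<Rightarrow> bool" where
  "has_coefficients l c \<longleftrightarrow> (\<exists>\<rho>>0. \<forall>z \<in> ball 0 \<rho>. \<forall>w \<in> ball 0 \<rho>.
     ((\<lambda>(i, j). c i j * z ^ i * cnj w ^ j) has_sum l z w) UNIV)"

text \<open>The second clause is linear independence of the family of functions \<open>l(\<cdot>, w)\<close>, \<open>w \<in> A\<close>, on
  \<open>U\<close>; in particular these functions are pairwise distinct. In the last clause \<open>s\<close> lists the index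
  set of a finite principal submatrix in increasing order.\<close>

definition regular_kernel :: "complex set \<Rightarrow> (complex \<Rightarrow> complex \<Rightarrow> complex) \<Rightarrow> bool" where
  "regular_kernel U l \<longleftrightarrow> open U \<and> 0 \<in> U \<and> holomorphic_kernel U l \<and>
     (\<exists>\<delta>>0. \<forall>A. finite A \<longrightarrow> A \<subseteq> U \<inter> ball 0 \<delta> \<longrightarrow>
        (\<forall>a. (\<forall>z \<in> U. (\<Sum>w\<in>A. a w * l z w) = 0) \<longrightarrow> (\<forall>w \<in> A. a w = 0))) \<and>
     (\<exists>c. has_coefficients l c \<and>
        (\<forall>n. \<forall>s :: nat \<Rightarrow> nat. strict_mono_on {..<n} s \<longrightarrow>
           Determinant.det (mat n n (\<lambda>(i, j). c (s i) (s j))) \<noteq> 0))"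

definition bergman_kernel :: "complex \<Rightarrow> complex \<Rightarrow> complex" where
  "bergman_kernel z w = 1 / (1 - z * cnj w)\<^sup>2"

end

theory Submission
  imports Defs "HOL-Complex_Analysis.Conformal_Mappings"
begin

text \<open>
  Write \<open>\<b>\<close> for the Bergman kernel. For a finite set \<open>S\<close> and a point \<open>z\<close> consider the functions in the
  space of \<open>l\<close> that vanish on \<open>S\<close>; let \<open>g\<close> be the reproducing kernel function of this subspace at
  \<open>z\<close>, and call its squared norm the gap of \<open>z\<close> over \<open>S\<close>. The gap is also \<open>g(z)\<close>, and it is the
  squared distance from \<open>l\<^sub>z\<close> to the span of the \<open>l\<^sub>w\<close>, \<open>w \<in> S\<close>. The theorem follows from comparing
  a lower and an upper bound for the gap when the points of \<open>S\<close> are many and close to \<open>z\<close>.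

  \<^bold>\<open>Lower bound.\<close> The Pick problem with value \<open>0\<close> on \<open>S\<close> and value \<open>a\<close> at \<open>z\<close> has a positive
  Pick matrix as soon as \<open>\<bar>a\<bar>\<^sup>2 \<b>(z,z)\<close> is at most the gap. Multiplying a
  Bergman space function that vanishes at a further point \<open>w\<close> by a solution gives a function with
  the zeros \<open>S \<union> {w}\<close>, so passing from \<open>S\<close> to \<open>S \<union> {w}\<close> shrinks the gap at most by the factor
  \<open>1 - \<bar>\<b>(z,w)\<bar>\<^sup>2 / (\<b>(z,z) \<b>(w,w))\<close> (\<open>gap_insert_ge\<close>). Near the origin this factor is about
  \<open>2 \<bar>z - w\<bar>\<^sup>2\<close> (\<open>bergman_separation_ge\<close>). Hence for every \<open>\<mu> < 2\<close> the gap is at least a constant times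
  \<open>\<mu>\<^sup>m \<Prod>\<bar>z - w\<bar>\<^sup>2\<close>, where \<open>m\<close> is the number of points of \<open>S\<close>.

  \<^bold>\<open>Upper bound.\<close> Divided by its norm, \<open>g\<close> is a unit vector \<open>h\<close>, a holomorphic function with zeros
  on \<open>S\<close>, and its value at \<open>z\<close> is the square root of the gap. If point evaluations are bounded on the
  circle of radius \<open>\<rho> < r\<close> about \<open>z\<close>, then the Schwarz lemma bounds \<open>h(z)\<close> by a constant times
  \<open>\<Prod>(\<bar>z - w\<bar> / \<rho>)\<close>, up to an error that disappears when \<open>S\<close> shrinks to \<open>z\<close>. Together with the
  lower bound this gives \<open>\<mu> \<rho>\<^sup>2 \<le> 1\<close>, and letting \<open>\<mu> \<rightarrow> 2\<close> and \<open>\<rho> \<rightarrow> r\<close> yields \<open>2 r\<^sup>2 \<le> 1\<close>.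

  \<^bold>\<open>Unbounded evaluations.\<close> The kernel is holomorphic in each variable separately, so it is not clear
  that \<open>l(y,y)\<close> is bounded on the circle. Jensen's inequality replaces the maximum of \<open>\<bar>h\<bar>\<close> by the mean
  of \<open>log \<bar>h\<bar>\<close>. For the latter it suffices that the functions \<open>h\<close> belonging to the various \<open>m\<close> are
  bounded at each point of the circle separately, which they are by \<open>l(y,y)\<^sup>1\<^sup>/\<^sup>2\<close>, and that they are bounded by
  \<open>B A\<^sup>m\<close> on the whole circle: dominated convergence applies to \<open>(log\<^sup>+ \<bar>h\<bar>) / m\<close>
  (\<open>growth_at_centre_le_one\<close>). The exponential bound comes from writing \<open>h\<close> as a combination of the
  functions \<open>l\<^sub>x\<close>, \<open>x \<in> S \<union> {z}\<close>. By Baire's theorem some small disc consists of points \<open>x\<close> for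
  which these functions are uniformly bounded; if the points are exponentially separated in that disc, the
  lower bound for the gaps controls the coefficients (\<open>vanishing_kernel_bound\<close>).
\<close>

section \<open>Growth at the centre of a disc and uniform bounds\<close>

lemma holomorphic_divide_zeros:
  assumes "finite S" "S \<subseteq> U" "open U" "g holomorphic_on U" "\<And>w. w \<in> S \<Longrightarrow> g w = 0"
  obtains h where "h holomorphic_on U" "\<And>x. x \<in> U \<Longrightarrow> g x = (\<Prod>w\<in>S. x - w) * h x"
proof -
  have "\<exists>h. h holomorphic_on U \<and> (\<forall>x\<in>U. g x = (\<Prod>w\<in>S. x - w) * h x)"
    using assms
  proof (induction S rule: finite_induct)
    case empty
    then show ?case by auto
  next
    case (insert v S)
    then obtain h where h: "h holomorphic_on U" "\<And>x. x \<in> U \<Longrightarrow> g x = (\<Prod>w\<in>S. x - w) * h x"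
      by auto
    define q where "q = (\<lambda>x. if x = v then deriv h v else (h x - h v) / (x - v))"
    have "q holomorphic_on U"
      unfolding q_def using insert.prems h(1) by (intro pole_lemma_open) auto
    moreover have "h v = 0"
      using h(2)[of v] insert by (auto simp: prod_zero_iff)
    then have "h x = (x - v) * q x" for x
      by (auto simp: q_def)
    then have "(\<Prod>w\<in>S. x - w) * h x = (\<Prod>w\<in>insert v S. x - w) * q x" for x
      using insert.hyps by simp
    then have "\<forall>x\<in>U. g x = (\<Prod>w\<in>insert v S. x - w) * q x"
      using h(2) by metis
    ultimately show ?case by blast
  qed
  then show ?thesis using that by blast
qed

text \<open>The product of the rotations of \<open>f\<close> by all \<open>n\<close>-th roots of unity is holomorphic with value
  \<open>f(p)\<^sup>n\<close> at the centre, and the maximum principle applies to it. This is a discrete form of the mean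
  value inequality for \<open>log \<bar>f\<bar>\<close>; it is insensitive to zeros of \<open>f\<close>.\<close>

lemma power_le_prod_rotations:
  fixes f :: "complex \<Rightarrow> complex"
  assumes \<rho>: "0 < \<rho>" and hol: "f holomorphic_on ball p \<rho>" and cont: "continuous_on (cball p \<rho>) f"
  obtains t where "0 \<le> t" "t \<le> 2 * pi"
    "norm (f p) ^ n \<le> (\<Prod>j<n. norm (f (p + of_real \<rho> * cis (t + 2 * pi * real j / real n))))"
proof -
  define R where "R = (\<lambda>(j::nat) x. p + cis (2 * pi * real j / real n) * (x - p))"
  define F where "F = (\<lambda>x. \<Prod>j<n. f (R j x))"
  have dR: "dist p (R j x) = dist p x" for j x
    by (simp add: R_def dist_norm norm_mult norm_minus_commute)
  have contR: "continuous_on A (R j)" and holR: "R j holomorphic_on A" for j A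
    unfolding R_def by (intro continuous_intros holomorphic_intros)+
  have contF: "continuous_on (cball p \<rho>) F"
    unfolding F_def
    by (intro continuous_on_prod continuous_on_compose2[OF cont contR]) (auto simp: dR)
  have holF: "F holomorphic_on ball p \<rho>"
  proof -
    have "(\<lambda>x. f (R j x)) holomorphic_on ball p \<rho>" for j
    proof -
      have "R j ` ball p \<rho> \<subseteq> ball p \<rho>"
        unfolding image_subset_iff mem_ball dR by simp
      from holomorphic_on_compose_gen[OF holR hol this] show ?thesis by (simp add: o_def)
    qed
    then show ?thesis
      unfolding F_def by (intro holomorphic_on_prod) auto
  qed
  have "\<exists>x0\<in>sphere p \<rho>. \<forall>x\<in>sphere p \<rho>. norm (F x) \<le> norm (F x0)"
    using \<rho> contF
    by (intro continuous_attains_sup continuous_intros) (auto intro: continuous_on_subset)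
  then obtain x0 where x0: "x0 \<in> sphere p \<rho>" "\<And>x. x \<in> sphere p \<rho> \<Longrightarrow> norm (F x) \<le> norm (F x0)"
    by metis
  have "norm (F p) \<le> norm (F x0)"
  proof (rule maximum_modulus_frontier[where f = F and S = "cball p \<rho>"])
    show "F holomorphic_on interior (cball p \<rho>)" using holF by simp
    show "continuous_on (closure (cball p \<rho>)) F" using contF by simp
    show "norm (F z) \<le> norm (F x0)" if "z \<in> frontier (cball p \<rho>)" for z
      using that \<rho> by (intro x0(2)) simp
    show "p \<in> cball p \<rho>" using \<rho> by simp
  qed (rule bounded_cball)
  moreover have "F p = f p ^ n"
    by (simp add: F_def R_def)
  moreover define t where "t = Arg2pi (x0 - p)"
  have n: "norm (x0 - p) = \<rho>"
    using x0(1) by (simp add: dist_norm norm_minus_commute)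
  have "x0 - p = of_real \<rho> * cis t"
    by (rule trans[OF Arg2pi_eq]) (simp only: n t_def cis_conv_exp)
  then have "x0 = p + of_real \<rho> * cis t"
    by (simp only: diff_eq_eq add.commute)
  then have "R j x0 = p + of_real \<rho> * cis (t + 2 * pi * real j / real n)" for j
    by (simp only: R_def cis_mult[symmetric] add_diff_cancel_left' mult_ac)
  then have "norm (F x0) = (\<Prod>j<n. norm (f (p + of_real \<rho> * cis (t + 2 * pi * real j / real n))))"
    by (simp add: F_def prod_norm)
  moreover have "0 \<le> t" "t \<le> 2 * pi"
    using Arg2pi_ge_0[of "x0 - p"] Arg2pi_lt_2pi[of "x0 - p"] by (auto simp: t_def)
  ultimately show ?thesis using that[of t] by (simp add: norm_power)
qed

lemma riemann_sum_le_integral: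
  fixes \<phi> :: "real \<Rightarrow> real"
  assumes cont: "continuous_on UNIV \<phi>" and s: "0 \<le> s" "real n * s \<le> L"
    and osc: "\<And>x y. a \<le> x \<Longrightarrow> x \<le> y \<Longrightarrow> y \<le> x + s \<Longrightarrow> y \<le> a + L \<Longrightarrow> \<phi> x \<le> \<phi> y + e"
  shows "(\<Sum>j<n. s * \<phi> (a + real j * s)) \<le> integral {a..a + real n * s} \<phi> + real n * s * e"
  using s(2)
proof (induction n)
  case 0
  then show ?case by simp
next
  case (Suc n)
  have int: "\<phi> integrable_on {x..y}" for x y
    by (intro integrable_continuous_real continuous_on_subset[OF cont]) auto
  let ?x = "a + real n * s"
  have n: "real n * s \<le> L" using Suc.prems s(1) by (simp add: algebra_simps)
  have "integral {?x..?x + s} (\<lambda>_. \<phi> ?x) \<le> integral {?x..?x + s} (\<lambda>y. \<phi> y + e)"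
  proof (rule integral_le)
    fix y assume "y \<in> {?x..?x + s}"
    then show "\<phi> ?x \<le> \<phi> y + e"
      using osc[of ?x y] Suc.prems s(1) by (simp add: algebra_simps)
  qed (auto intro!: integrable_add int)
  also have "\<dots> = integral {?x..?x + s} \<phi> + s * e"
    using s(1) by (subst integral_add) (auto intro: int)
  finally have "s * \<phi> ?x \<le> integral {?x..?x + s} \<phi> + s * e"
    using s(1) by simp
  moreover have "integral {a..?x} \<phi> + integral {?x..?x + s} \<phi> = integral {a..?x + s} \<phi>"
    using s(1) by (intro Henstock_Kurzweil_Integration.integral_combine int) auto
  moreover have "?x + s = a + real (Suc n) * s"
    by (simp add: algebra_simps)
  ultimately show ?case
    using Suc.IH[OF n] by (simp add: algebra_simps)
qed

text \<open>A form of Jensen's inequality, obtained from Riemann sums over roots of unity. The maximum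
  principle provides a starting angle in \<open>[0, 2\<pi>]\<close> over which there is no control. As \<open>\<phi> \<ge> 0\<close>, its
  integral over a period starting there is at most the integral over \<open>[0, 4\<pi>]\<close>; the factor 2 that is
  lost against the sharp inequality is harmless, as the integrals tend to \<open>0\<close> in the application.\<close>

lemma norm_centre_le_exp_integral:
  fixes f :: "complex \<Rightarrow> complex" and \<phi> :: "real \<Rightarrow> real"
  assumes \<rho>: "0 < \<rho>" and hol: "f holomorphic_on ball p \<rho>" and cont: "continuous_on (cball p \<rho>) f"
    and \<phi>: "continuous_on UNIV \<phi>" "\<And>t. 0 \<le> \<phi> t"
    and le: "\<And>t. norm (f (p + of_real \<rho> * cis t)) \<le> exp (\<phi> t)"
  shows "norm (f p) \<le> exp (integral {0..4 * pi} \<phi> / (2 * pi))"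
proof -
  let ?I = "integral {0..4 * pi} \<phi>"
  have int: "\<phi> integrable_on {x..y}" for x y
    by (intro integrable_continuous_real continuous_on_subset[OF \<phi>(1)]) auto
  have *: "norm (f p) \<le> exp (?I / (2 * pi) + e)" if e: "0 < e" for e
  proof -
    have "uniformly_continuous_on {0..4 * pi} \<phi>"
      by (intro compact_uniformly_continuous continuous_on_subset[OF \<phi>(1)]) auto
    then obtain d where d: "0 < d"
      "\<And>x y. x \<in> {0..4 * pi} \<Longrightarrow> y \<in> {0..4 * pi} \<Longrightarrow> dist y x < d \<Longrightarrow> dist (\<phi> y) (\<phi> x) < e"
      using e unfolding uniformly_continuous_on_def by metis
    obtain n :: nat where n: "2 * pi / d < real n" using reals_Archimedean2 by blast
    have "0 < 2 * pi / d" using d by simp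
    then have n0: "0 < n" using n by (metis less_trans of_nat_0_less_iff)
    define s where "s = 2 * pi / real n"
    have s: "0 \<le> s" "real n * s = 2 * pi" "s < d"
      using n n0 d by (auto simp: s_def field_simps)
    obtain t where t: "0 \<le> t" "t \<le> 2 * pi"
      and tle: "norm (f p) ^ n \<le> (\<Prod>j<n. norm (f (p + of_real \<rho> * cis (t + 2 * pi * real j / real n))))"
      using power_le_prod_rotations[OF \<rho> hol cont] by blast
    have "(\<Sum>j<n. s * \<phi> (t + real j * s)) \<le> integral {t..t + real n * s} \<phi> + real n * s * e"
    proof (rule riemann_sum_le_integral[where L = "2 * pi"])
      fix x y assume "t \<le> x" "x \<le> y" "y \<le> x + s" "y \<le> t + 2 * pi"
      then have "dist (\<phi> y) (\<phi> x) < e"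
        using t s by (intro d) (auto simp: dist_real_def)
      then show "\<phi> x \<le> \<phi> y + e" by (simp add: dist_real_def abs_if split: if_splits)
    qed (use s \<phi> in auto)
    also have "integral {t..t + real n * s} \<phi> \<le> ?I"
      using t s \<phi> by (intro integral_subset_le int) auto
    finally have "(\<Sum>j<n. s * \<phi> (t + real j * s)) \<le> ?I + real n * s * e"
      by simp
    then have sum: "(\<Sum>j<n. \<phi> (t + real j * s)) \<le> real n * (?I / (2 * pi) + e)"
    proof -
      assume "(\<Sum>j<n. s * \<phi> (t + real j * s)) \<le> ?I + real n * s * e"
      then have "s * (\<Sum>j<n. \<phi> (t + real j * s)) \<le> ?I + 2 * pi * e"
        by (simp only: s(2) sum_distrib_left)
      then have "real n * (s * (\<Sum>j<n. \<phi> (t + real j * s))) \<le> real n * (?I + 2 * pi * e)"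
        by (rule mult_left_mono) simp
      then have "2 * pi * (\<Sum>j<n. \<phi> (t + real j * s)) \<le> real n * (?I + 2 * pi * e)"
        by (simp only: mult.assoc[symmetric] s(2))
      then show ?thesis by (simp add: field_simps)
    qed
    have "norm (f p) ^ n \<le> (\<Prod>j<n. exp (\<phi> (t + 2 * pi * real j / real n)))"
      using tle by (rule order_trans) (intro prod_mono conjI le norm_ge_zero)
    also have "\<dots> = exp (\<Sum>j<n. \<phi> (t + real j * s))"
      by (simp add: exp_sum s_def mult.commute)
    also have "\<dots> \<le> exp (?I / (2 * pi) + e) ^ n"
      using sum by (simp add: exp_of_nat_mult[symmetric])
    finally show ?thesis
      using n0 by (simp add: power_mono_iff)
  qed
  show ?thesis
  proof (rule tendsto_lowerbound)
    show "((\<lambda>e. exp (?I / (2 * pi) + e)) \<longlongrightarrow> exp (?I / (2 * pi))) (at_right 0)"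
      by (rule tendsto_eq_intros refl | simp)+
    show "\<forall>\<^sub>F e in at_right 0. norm (f p) \<le> exp (?I / (2 * pi) + e)"
      using * by (auto simp: eventually_at_right_field intro!: exI[of _ 1])
  qed simp
qed

text \<open>The Schwarz lemma for functions with zeros \<open>S m\<close> close to \<open>p\<close>, on the scale of \<open>m\<close>-th roots and
  without a common bound on the circle. On the circle the divisor \<open>\<Prod>(x - w)\<close> is at least
  \<open>(\<rho> - \<epsilon>)\<^sup>m\<close> in absolute value, and the mean of \<open>(log\<^sup>+ \<bar>h m\<bar>) / m\<close> tends to \<open>0\<close> by dominated convergence: the exponential
  bound is the dominating constant, the pointwise bound gives the limit.\<close>

lemma growth_at_centre_le_one:
  fixes h :: "nat \<Rightarrow> complex \<Rightarrow> complex" and S :: "nat \<Rightarrow> complex set"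
  assumes \<epsilon>: "\<epsilon> < \<rho>" "0 < \<rho>" and U: "open U" "cball p \<rho> \<subseteq> U"
    and hol: "\<And>m. h m holomorphic_on U"
    and S: "\<And>m. finite (S m)" "\<And>m. card (S m) = m" "\<And>m. S m \<subseteq> ball p \<epsilon> - {p}"
    and zero: "\<And>m w. w \<in> S m \<Longrightarrow> h m w = 0"
    and pointwise: "\<And>y. y \<in> sphere p \<rho> \<Longrightarrow> \<exists>N. \<forall>m. norm (h m y) \<le> N"
    and exponential: "\<And>m y. y \<in> sphere p \<rho> \<Longrightarrow> norm (h m y) \<le> B * A ^ m"
    and AB: "1 \<le> A" "1 \<le> B"
    and growth: "\<And>m. c * \<theta> ^ m * (\<Prod>w\<in>S m. norm (p - w)) \<le> norm (h m p) * (\<rho> - \<epsilon>) ^ m"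
    and c: "0 < c" and \<theta>: "0 < \<theta>"
  shows "\<theta> \<le> 1"
proof -
  define e where "e = (\<lambda>t. p + of_real \<rho> * cis t)"
  have e_in: "e t \<in> sphere p \<rho>" for t
    using \<epsilon> by (simp add: e_def dist_norm norm_mult)
  have conte: "continuous_on A e" for A
    unfolding e_def by (intro continuous_intros)
  define u where "u = (\<lambda>m t. ln (max (norm (h m (e t))) 1) / real m)"
  have contu: "continuous_on T (u m)" for m T
  proof -
    have "continuous_on (sphere p \<rho>) (h m)"
      using U(2) by (intro continuous_on_subset[OF holomorphic_on_imp_continuous_on[OF hol]]) auto
    then have "continuous_on T (\<lambda>t. h m (e t))"
      using e_in by (intro continuous_on_compose2[OF _ conte]) auto
    then show ?thesis
      unfolding u_def divide_inverse by (intro continuous_intros) auto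
  qed
  have u_nonneg: "0 \<le> u m t" for m t
    by (simp add: u_def)
  have u_bound: "u m t \<le> ln B + ln A" for m t
  proof (cases "m = 0")
    case True
    then show ?thesis using AB by (simp add: u_def)
  next
    case False
    have "1 * 1 \<le> B * A ^ m"
      using AB by (intro mult_mono one_le_power) auto
    then have "max (norm (h m (e t))) 1 \<le> B * A ^ m"
      using exponential[OF e_in] by simp
    then have "ln (max (norm (h m (e t))) 1) \<le> ln (B * A ^ m)"
      using AB by (subst ln_le_cancel_iff) auto
    also have "\<dots> = ln B + real m * ln A"
      using AB by (simp add: ln_mult ln_realpow)
    also have "\<dots> \<le> real m * (ln B + ln A)"
      using AB False mult_right_mono[of 1 "real m" "ln B"] by (simp add: algebra_simps)
    finally show ?thesis using False by (simp add: u_def field_simps)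
  qed
  have u_lim: "(\<lambda>m. u m t) \<longlonglongrightarrow> 0" for t
  proof -
    obtain N where N: "\<And>m. norm (h m (e t)) \<le> N" using pointwise[OF e_in] by blast
    show ?thesis
    proof (rule tendsto_sandwich)
      show "\<forall>\<^sub>F m in sequentially. 0 \<le> u m t" "(\<lambda>_. 0) \<longlonglongrightarrow> (0 :: real)"
        by (auto simp: u_nonneg)
      have "ln (max (norm (h m (e t))) 1) \<le> ln (max N 1)" for m
        using N[of m] by (subst ln_le_cancel_iff) auto
      then have "u m t \<le> ln (max N 1) * inverse (real m)" for m
        unfolding u_def divide_inverse by (rule mult_right_mono) simp
      then show "\<forall>\<^sub>F m in sequentially. u m t \<le> ln (max N 1) * inverse (real m)"
        by (rule always_eventually[OF allI])
      show "(\<lambda>m. ln (max N 1) * inverse (real m)) \<longlonglongrightarrow> 0"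
        by (rule tendsto_mult_right_zero[OF lim_inverse_n])
    qed
  qed
  have lim: "(\<lambda>m. integral {0..4 * pi} (u m)) \<longlonglongrightarrow> integral {0..4 * pi} (\<lambda>_. 0 :: real)"
  proof (rule dominated_convergence)
    show "u m integrable_on {0..4 * pi}" for m
      by (intro integrable_continuous_real contu)
    show "norm (u m t) \<le> ln B + ln A" for m t
      using u_nonneg u_bound by simp
  qed (auto simp: u_lim)
  have key: "ln c * inverse (real m) + ln \<theta> \<le> integral {0..4 * pi} (u m) / (2 * pi)" if m: "1 \<le> m" for m
  proof -
    have "S m \<subseteq> U" using S(3) U(2) \<epsilon>(1) by (force simp: subset_iff)
    then obtain q where q: "q holomorphic_on U" "\<And>x. x \<in> U \<Longrightarrow> h m x = (\<Prod>w\<in>S m. x - w) * q x"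
      using holomorphic_divide_zeros[OF S(1) _ U(1) hol zero] by metis
    have pos: "0 < (\<Prod>w\<in>S m. norm (p - w))" using S(3) by (intro prod_pos) auto
    have "p \<in> U" using U(2) \<epsilon>(2) by auto
    then have "norm (h m p) = (\<Prod>w\<in>S m. norm (p - w)) * norm (q p)"
      using q(2) by (simp add: norm_mult prod_norm)
    then have "(c * \<theta> ^ m) * (\<Prod>w\<in>S m. norm (p - w))
        \<le> (norm (q p) * (\<rho> - \<epsilon>) ^ m) * (\<Prod>w\<in>S m. norm (p - w))"
      using growth[of m] by (simp add: mult_ac)
    then have "c * \<theta> ^ m \<le> norm (q p) * (\<rho> - \<epsilon>) ^ m"
      using pos by (rule mult_right_le_imp_le)
    also have "\<dots> = norm (of_real ((\<rho> - \<epsilon>) ^ m) * q p)"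
      using \<epsilon> by (simp add: norm_mult norm_of_real del: of_real_power of_real_diff)
    also have "\<dots> \<le> exp (integral {0..4 * pi} (\<lambda>t. real m * u m t) / (2 * pi))"
    proof (rule norm_centre_le_exp_integral[where f = "\<lambda>x. of_real ((\<rho> - \<epsilon>) ^ m) * q x"])
      show "(\<lambda>x. of_real ((\<rho> - \<epsilon>) ^ m) * q x) holomorphic_on ball p \<rho>"
        using U(2) by (intro holomorphic_intros holomorphic_on_subset[OF q(1)]) auto
      show "continuous_on (cball p \<rho>) (\<lambda>x. of_real ((\<rho> - \<epsilon>) ^ m) * q x)"
        using U(2) by (intro continuous_intros
            continuous_on_subset[OF holomorphic_on_imp_continuous_on[OF q(1)]])
      fix t
      have "(\<rho> - \<epsilon>) ^ m = (\<Prod>w\<in>S m. \<rho> - \<epsilon>)" by (simp add: S)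
      also have "\<dots> \<le> (\<Prod>w\<in>S m. norm (e t - w))"
      proof (intro prod_mono conjI)
        fix w assume "w \<in> S m"
        then have "dist p w < \<epsilon>" using S(3)[of m] by auto
        moreover have "dist p (e t) = \<rho>" using e_in by simp
        ultimately show "\<rho> - \<epsilon> \<le> norm (e t - w)"
          using dist_triangle[of p "e t" w] by (simp add: dist_norm[symmetric] dist_commute)
      qed (use \<epsilon> in auto)
      finally have "(\<rho> - \<epsilon>) ^ m * norm (q (e t)) \<le> (\<Prod>w\<in>S m. norm (e t - w)) * norm (q (e t))"
        by (rule mult_right_mono) simp
      also have "\<dots> = norm (h m (e t))"
      proof -
        have "e t \<in> U" using e_in[of t] U(2) sphere_cball by blast
        then show ?thesis using q(2) by (simp add: norm_mult prod_norm)
      qed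
      also have "\<dots> \<le> exp (real m * u m t)"
        using m by (simp add: u_def)
      finally have "(\<rho> - \<epsilon>) ^ m * norm (q (e t)) \<le> exp (real m * u m t)" .
      moreover have "norm (complex_of_real ((\<rho> - \<epsilon>) ^ m)) = (\<rho> - \<epsilon>) ^ m"
        using \<epsilon>(1) by (simp only: norm_of_real) simp
      ultimately show "norm (of_real ((\<rho> - \<epsilon>) ^ m) * q (p + of_real \<rho> * cis t)) \<le> exp (real m * u m t)"
        by (simp only: norm_mult e_def)
      show "continuous_on UNIV (\<lambda>t. real m * u m t)"
        by (intro continuous_on_mult continuous_on_const contu)
      show "0 \<le> real m * u m t"
        using u_nonneg by simp
    qed (rule \<epsilon>)
    finally have "ln (c * \<theta> ^ m) \<le> ln (exp (real m * integral {0..4 * pi} (u m) / (2 * pi)))"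
      using c \<theta> by (subst ln_le_cancel_iff) auto
    then show ?thesis
      using c \<theta> m by (simp add: ln_mult ln_realpow field_simps)
  qed
  have "(\<lambda>m. ln c * inverse (real m) + ln \<theta>) \<longlonglongrightarrow> ln c * 0 + ln \<theta>"
    by (intro tendsto_add tendsto_mult tendsto_const lim_inverse_n)
  moreover have "(\<lambda>m. integral {0..4 * pi} (u m) / (2 * pi))
      \<longlonglongrightarrow> integral {0..4 * pi} (\<lambda>_. 0 :: real) / (2 * pi)"
    by (rule tendsto_divide[OF lim tendsto_const]) simp
  ultimately have "ln c * 0 + ln \<theta> \<le> integral {0..4 * pi} (\<lambda>_. 0 :: real) / (2 * pi)"
    by (rule LIMSEQ_le) (use key in blast)
  then show ?thesis using \<theta> by simp
qed

text \<open>The closed sets of those \<open>x\<close> for which \<open>F x\<close> is bounded by \<open>n\<close> cover the ball, so by Baire's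
  theorem one of them has interior points.\<close>

lemma exists_ball_of_uniform_bound:
  fixes F :: "'a::euclidean_space \<Rightarrow> 'b \<Rightarrow> 'c::real_normed_vector"
  assumes t: "0 < t" and cont: "\<And>y. y \<in> Y \<Longrightarrow> continuous_on (cball a t) (\<lambda>x. F x y)"
    and bdd: "\<And>x. x \<in> cball a t \<Longrightarrow> bounded (F x ` Y)"
  obtains p \<epsilon> M where "0 < \<epsilon>" "ball p \<epsilon> \<subseteq> ball a t"
    "\<And>x y. x \<in> ball p \<epsilon> \<Longrightarrow> y \<in> Y \<Longrightarrow> norm (F x y) \<le> M"
proof -
  let ?C = "cball a t"
  define E where "E = (\<lambda>n::nat. {x \<in> ?C. \<forall>y\<in>Y. norm (F x y) \<le> real n})"
  have closed: "closed (E n)" for n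
  proof -
    have "E n = ?C \<inter> (\<Inter>y\<in>Y. {x \<in> ?C. norm (F x y) \<le> real n})"
      by (auto simp: E_def)
    moreover have "closed {x \<in> ?C. norm (F x y) \<le> real n}" if "y \<in> Y" for y
      using that by (intro continuous_on_closed_Collect_le continuous_intros cont) auto
    ultimately show ?thesis by (auto intro!: closed_Int closed_INT)
  qed
  have "\<exists>n p \<epsilon>. 0 < \<epsilon> \<and> ball p \<epsilon> \<subseteq> ball a t \<inter> E n"
  proof (rule ccontr)
    assume no_ball: "\<nexists>n p \<epsilon>. 0 < \<epsilon> \<and> ball p \<epsilon> \<subseteq> ball a t \<inter> E n"
    have "?C \<subseteq> closure (\<Inter>n. ?C - E n)"
    proof (rule Baire)
      fix T assume "T \<in> range (\<lambda>n. ?C - E n)"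
      then obtain n where T: "T = ?C - E n" by blast
      have "x \<in> closure T" if x: "x \<in> ?C" for x
      proof (rule ccontr)
        assume "x \<notin> closure T"
        then have "open (- closure T)" "x \<in> - closure T" by auto
        moreover have "x \<in> closure (ball a t)" using x t by simp
        ultimately have "- closure T \<inter> ball a t \<noteq> {}"
          using open_Int_closure_eq_empty by blast
        moreover have "open (- closure T \<inter> ball a t)" by auto
        ultimately obtain p \<epsilon> where "0 < \<epsilon>" "ball p \<epsilon> \<subseteq> - closure T \<inter> ball a t"
          by (meson ex_in_conv open_contains_ball)
        moreover have "- closure T \<inter> ball a t \<subseteq> ball a t \<inter> E n"
          using closure_subset[of T] ball_subset_cball[of a t] unfolding T by blast
        ultimately show False using no_ball by blast
      qed
      moreover have "openin (top_of_set ?C) T"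
        unfolding T Diff_eq using closed[of n] by (auto intro!: openin_open_Int simp: Compl_eq_Diff_UNIV)
      ultimately show "openin (top_of_set ?C) T \<and> ?C \<subseteq> closure T" by blast
    qed auto
    moreover have "(\<Inter>n. ?C - E n) = {}"
    proof -
      have "\<exists>n. x \<in> E n" if x: "x \<in> ?C" for x
      proof -
        obtain B where "\<And>y. y \<in> Y \<Longrightarrow> norm (F x y) \<le> B"
          using bdd[OF x] unfolding bounded_iff by blast
        moreover obtain n where "B \<le> real n" using real_arch_simple by blast
        ultimately show ?thesis using x by (force simp: E_def intro: order_trans)
      qed
      then show ?thesis by blast
    qed
    ultimately have "?C \<subseteq> {}" by (metis closure_empty)
    then show False using t by auto
  qed
  then show ?thesis using that unfolding E_def by blast
qed

section \<open>Hilbert function spaces and subspaces of functions with prescribed zeros\<close>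

locale hilbert_functions =
  fixes X :: "'x set" and H :: "'x function_space"
  assumes hilbert: "hilbert_function_space X H"
begin

lemma
  shows zero_mem: "(\<lambda>z. 0) \<in> fns H"
    and add_mem: "f \<in> fns H \<Longrightarrow> g \<in> fns H \<Longrightarrow> (\<lambda>z. f z + g z) \<in> fns H"
    and scale_mem: "f \<in> fns H \<Longrightarrow> (\<lambda>z. c * f z) \<in> fns H"
    and ip_add_left: "f \<in> fns H \<Longrightarrow> g \<in> fns H \<Longrightarrow> h \<in> fns H \<Longrightarrow>
      ip H (\<lambda>z. f z + g z) h = ip H f h + ip H g h"
    and ip_scale_left: "f \<in> fns H \<Longrightarrow> h \<in> fns H \<Longrightarrow> ip H (\<lambda>z. c * f z) h = c * ip H f h"
    and ip_cnj: "f \<in> fns H \<Longrightarrow> g \<in> fns H \<Longrightarrow> ip H g f = cnj (ip H f g)"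
    and ip_nonneg: "f \<in> fns H \<Longrightarrow> 0 \<le> ip H f f"
    and ip_definite: "f \<in> fns H \<Longrightarrow> ip H f f = 0 \<Longrightarrow> f = (\<lambda>z. 0)"
  using hilbert unfolding hilbert_function_space_def by blast+

lemma diff_mem:
  assumes "f \<in> fns H" "g \<in> fns H"
  shows "(\<lambda>z. f z - c * g z) \<in> fns H"
  using add_mem[OF assms(1) scale_mem[OF assms(2), of "- c"]] by simp

lemma ip_diff_left:
  assumes "f \<in> fns H" "g \<in> fns H" "h \<in> fns H"
  shows "ip H (\<lambda>z. f z - c * g z) h = ip H f h - c * ip H g h"
  using ip_add_left[OF assms(1) scale_mem[OF assms(2), of "- c"] assms(3)] ip_scale_left[OF assms(2,3), of "- c"]
  by simp

lemma ip_diff_right: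
  assumes "f \<in> fns H" "g \<in> fns H" "h \<in> fns H"
  shows "ip H h (\<lambda>z. f z - c * g z) = ip H h f - cnj c * ip H h g"
proof -
  have "ip H h (\<lambda>z. f z - c * g z) = cnj (ip H (\<lambda>z. f z - c * g z) h)"
    by (rule ip_cnj) (use assms diff_mem in auto)
  also have "\<dots> = cnj (ip H f h) - cnj c * cnj (ip H g h)"
    by (simp add: ip_diff_left assms)
  also have "\<dots> = ip H h f - cnj c * ip H h g"
    by (simp only: ip_cnj[OF assms(1,3)] ip_cnj[OF assms(2,3)])
  finally show ?thesis .
qed

lemma sum_mem: "finite A \<Longrightarrow> (\<And>x. x \<in> A \<Longrightarrow> F x \<in> fns H) \<Longrightarrow> (\<lambda>y. \<Sum>x\<in>A. a x * F x y) \<in> fns H"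
  by (induction A rule: finite_induct) (auto intro!: zero_mem add_mem scale_mem)

lemma ip_sum_left:
  assumes "finite A" "\<And>x. x \<in> A \<Longrightarrow> F x \<in> fns H" "h \<in> fns H"
  shows "ip H (\<lambda>y. \<Sum>x\<in>A. a x * F x y) h = (\<Sum>x\<in>A. a x * ip H (F x) h)"
  using assms
proof (induction A rule: finite_induct)
  case empty
  have "ip H (\<lambda>z. 0 * 0) h = 0 * ip H (\<lambda>z. 0) h"
    by (rule ip_scale_left) (use empty zero_mem in auto)
  then show ?case by simp
next
  case (insert x A)
  then show ?case
    by (simp add: ip_add_left ip_scale_left sum_mem scale_mem)
qed

lemma ip_sum_right:
  assumes "finite A" "\<And>x. x \<in> A \<Longrightarrow> F x \<in> fns H" "h \<in> fns H"
  shows "ip H h (\<lambda>y. \<Sum>x\<in>A. a x * F x y) = (\<Sum>x\<in>A. cnj (a x) * ip H h (F x))"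
proof -
  have "ip H h (\<lambda>y. \<Sum>x\<in>A. a x * F x y) = cnj (ip H (\<lambda>y. \<Sum>x\<in>A. a x * F x y) h)"
    by (rule ip_cnj) (use assms sum_mem in auto)
  also have "\<dots> = (\<Sum>x\<in>A. cnj (a x) * cnj (ip H (F x) h))"
    by (simp add: ip_sum_left assms)
  also have "\<dots> = (\<Sum>x\<in>A. cnj (a x) * ip H h (F x))"
    by (intro sum.cong refl arg_cong2[where f = "(*)"] ip_cnj[symmetric] assms)
  finally show ?thesis .
qed

lemma fnorm_nonneg: "f \<in> fns H \<Longrightarrow> 0 \<le> fnorm H f"
  using ip_nonneg[of f] by (simp add: fnorm_def less_eq_complex_def)

lemma ip_self: "f \<in> fns H \<Longrightarrow> ip H f f = of_real ((fnorm H f)\<^sup>2)"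
  using ip_nonneg[of f] by (simp add: fnorm_def less_eq_complex_def complex_eq_iff)

lemma fnorm_zero: "f \<in> fns H \<Longrightarrow> fnorm H f = 0 \<Longrightarrow> f = (\<lambda>z. 0)"
  using ip_self[of f] ip_definite[of f] by simp

lemma fnorm_scale: "f \<in> fns H \<Longrightarrow> fnorm H (\<lambda>z. c * f z) = norm c * fnorm H f"
proof -
  assume f: "f \<in> fns H"
  have "ip H (\<lambda>z. c * f z) (\<lambda>z. c * f z) = c * ip H f (\<lambda>z. c * f z)"
    using f by (intro ip_scale_left scale_mem)
  also have "ip H f (\<lambda>z. c * f z) = cnj (ip H (\<lambda>z. c * f z) f)"
    using f by (intro ip_cnj scale_mem)
  also have "\<dots> = cnj c * of_real ((fnorm H f)\<^sup>2)"
    using f by (simp add: ip_scale_left ip_self)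
  also have "c * (cnj c * of_real ((fnorm H f)\<^sup>2)) = of_real ((norm c * fnorm H f)\<^sup>2)"
    by (simp only: power_mult_distrib of_real_mult complex_norm_square mult.assoc)
  finally have "(fnorm H (\<lambda>z. c * f z))\<^sup>2 = (norm c * fnorm H f)\<^sup>2"
    using ip_self[OF scale_mem[OF f, of c]] by (metis of_real_eq_iff)
  then show ?thesis
    using f fnorm_nonneg scale_mem by (simp add: power2_eq_iff_nonneg)
qed

lemma Cauchy_Schwarz:
  assumes f: "f \<in> fns H" and g: "g \<in> fns H"
  shows "norm (ip H f g) \<le> fnorm H f * fnorm H g"
proof (cases "fnorm H g = 0")
  case True
  then have "g = (\<lambda>z. 0 * 0)" using fnorm_zero[OF g] by simp
  then have "ip H g f = 0" using ip_scale_left[OF zero_mem f, of 0] by simp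
  then show ?thesis using ip_cnj[OF g f] True by simp
next
  case False
  then have pos: "0 < (fnorm H g)\<^sup>2" by simp
  define c where "c = ip H f g / of_real ((fnorm H g)\<^sup>2)"
  let ?d = "\<lambda>z. f z - c * g z"
  have d: "?d \<in> fns H" using diff_mem f g by simp
  have cg: "c * of_real ((fnorm H g)\<^sup>2) = ip H f g" using pos by (simp add: c_def)
  have "ip H ?d g = 0"
    using f g cg by (simp add: ip_diff_left ip_self del: of_real_power)
  then have "ip H ?d ?d = ip H ?d f"
    using f g d by (simp add: ip_diff_right)
  also have "\<dots> = of_real ((fnorm H f)\<^sup>2) - c * cnj (ip H f g)"
    using f g by (simp add: ip_diff_left ip_self ip_cnj[OF f g] del: of_real_power)
  also have "c * cnj (ip H f g) = of_real ((norm (ip H f g))\<^sup>2 / (fnorm H g)\<^sup>2)"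
    by (simp add: c_def complex_norm_square del: of_real_power)
  finally have "0 \<le> (fnorm H f)\<^sup>2 - (norm (ip H f g))\<^sup>2 / (fnorm H g)\<^sup>2"
    using ip_nonneg[OF d] by (simp add: less_eq_complex_def del: of_real_power)
  then have "(norm (ip H f g))\<^sup>2 \<le> (fnorm H f * fnorm H g)\<^sup>2"
    using pos by (simp add: field_simps power_mult_distrib)
  then show ?thesis
    by (rule power2_le_imp_le) (use f g fnorm_nonneg in simp)
qed

end

locale rkhs =
  fixes X :: "'x set" and k :: "'x \<Rightarrow> 'x \<Rightarrow> complex" and H :: "'x function_space"
  assumes rkhs: "is_rkhs X k H"
begin

sublocale hilbert_functions X H
  using rkhs by unfold_locales (simp add: is_rkhs_def)

definition kfun :: "'x \<Rightarrow> 'x \<Rightarrow> complex" where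
  "kfun w = restr X (\<lambda>z. k z w)"

lemma kfun_mem: "w \<in> X \<Longrightarrow> kfun w \<in> fns H"
  and reproducing: "w \<in> X \<Longrightarrow> f \<in> fns H \<Longrightarrow> ip H f (kfun w) = f w"
  using rkhs by (auto simp: is_rkhs_def kfun_def)

lemma kfun_eval: "z \<in> X \<Longrightarrow> kfun w z = k z w"
  by (simp add: kfun_def restr_def)

lemma fnorm_kfun: "w \<in> X \<Longrightarrow> (fnorm H (kfun w))\<^sup>2 = Re (k w w)"
  using ip_self[OF kfun_mem, of w] reproducing[OF _ kfun_mem, of w w] kfun_eval[of w w]
  by simp

lemma kernel_diagonal: "w \<in> X \<Longrightarrow> k w w = of_real (Re (k w w))"
  using ip_self[OF kfun_mem, of w] reproducing[OF _ kfun_mem, of w w] kfun_eval[of w w] fnorm_kfun[of w]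
  by simp

lemma kernel_diagonal_nonneg: "w \<in> X \<Longrightarrow> 0 \<le> Re (k w w)"
  by (simp add: fnorm_kfun[symmetric])

lemma kernel_hermitian: "z \<in> X \<Longrightarrow> w \<in> X \<Longrightarrow> k w z = cnj (k z w)"
  using ip_cnj[OF kfun_mem kfun_mem, of z w] by (simp add: reproducing kfun_mem kfun_eval)

lemma norm_eval_le:
  assumes "f \<in> fns H" "y \<in> X"
  shows "(norm (f y))\<^sup>2 \<le> (fnorm H f)\<^sup>2 * Re (k y y)"
proof -
  have "norm (f y) \<le> fnorm H f * fnorm H (kfun y)"
    using Cauchy_Schwarz[OF assms(1) kfun_mem[OF assms(2)]] reproducing[OF assms(2,1)] by simp
  then have "(norm (f y))\<^sup>2 \<le> (fnorm H f * fnorm H (kfun y))\<^sup>2"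
    by (rule power_mono) simp
  then show ?thesis using fnorm_kfun[OF assms(2)] by (simp add: power_mult_distrib)
qed

definition kspan :: "'x set \<Rightarrow> ('x \<Rightarrow> complex) set" where
  "kspan A = {f. \<exists>a. f = (\<lambda>y. \<Sum>x\<in>A. a x * kfun x y)}"

lemma kspan_mem: "finite A \<Longrightarrow> A \<subseteq> X \<Longrightarrow> f \<in> kspan A \<Longrightarrow> f \<in> fns H"
  by (auto simp: kspan_def intro!: sum_mem kfun_mem)

lemma kspan_mono:
  assumes "finite B" "A \<subseteq> B" "f \<in> kspan A"
  shows "f \<in> kspan B"
proof -
  obtain a where f: "f = (\<lambda>y. \<Sum>x\<in>A. a x * kfun x y)" using assms by (auto simp: kspan_def)
  have "f = (\<lambda>y. \<Sum>x\<in>B. (if x \<in> A then a x else 0) * kfun x y)"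
    unfolding f using assms by (intro ext sum.mono_neutral_cong_left) auto
  then show ?thesis by (auto simp: kspan_def)
qed

lemma kspan_diff:
  assumes "f \<in> kspan A" "g \<in> kspan A"
  shows "(\<lambda>y. f y - c * g y) \<in> kspan A"
proof -
  obtain a b where "f = (\<lambda>y. \<Sum>x\<in>A. a x * kfun x y)" "g = (\<lambda>y. \<Sum>x\<in>A. b x * kfun x y)"
    using assms by (auto simp: kspan_def)
  then have "(\<lambda>y. f y - c * g y) = (\<lambda>y. \<Sum>x\<in>A. (a x - c * b x) * kfun x y)"
    by (simp add: sum_distrib_left sum_subtractf algebra_simps)
  then show ?thesis by (auto simp: kspan_def)
qed

text \<open>The reproducing kernel function at \<open>z\<close> of the subspace of functions that vanish on \<open>S\<close>. Membership
  in the span is part of the notion because it makes these functions holomorphic when the kernel is,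
  and because the coefficients have to be estimated later.\<close>

definition is_vanishing_kernel :: "'x set \<Rightarrow> 'x \<Rightarrow> ('x \<Rightarrow> complex) \<Rightarrow> bool" where
  "is_vanishing_kernel S z g \<longleftrightarrow> g \<in> kspan (insert z S) \<and> (\<forall>w\<in>S. g w = 0) \<and>
     (\<forall>f\<in>fns H. (\<forall>w\<in>S. f w = 0) \<longrightarrow> ip H f g = f z)"

text \<open>A Gram--Schmidt step adds one zero \<open>w\<close>: subtract the multiple of the kernel function at \<open>w\<close> that
  makes the value at \<open>w\<close> vanish. If that kernel function is \<open>0\<close> at \<open>w\<close>, then it is \<open>0\<close>, every function in the
  subspace already vanishes at \<open>w\<close>, and the division by zero in \<open>c\<close> yields the correct multiple \<open>0\<close>.\<close>

lemma vanishing_kernel_exists: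
  assumes "finite S" "S \<subseteq> X" "z \<in> X"
  shows "\<exists>g. is_vanishing_kernel S z g"
  using assms
proof (induction S arbitrary: z rule: finite_induct)
  case empty
  have "kfun z = (\<lambda>y. \<Sum>x\<in>{z}. 1 * kfun x y)" by simp
  then have "kfun z \<in> kspan {z}" unfolding kspan_def
    by (intro CollectI exI[of _ "\<lambda>_. 1"])
  then show ?case using empty reproducing by (auto simp: is_vanishing_kernel_def)
next
  case (insert w S)
  obtain g where g: "is_vanishing_kernel S z g" using insert by auto
  obtain g' where g': "is_vanishing_kernel S w g'" using insert by auto
  have mem: "g \<in> fns H" "g' \<in> fns H"
    using g g' insert.prems insert.hyps(1) kspan_mem[of "insert z S" g] kspan_mem[of "insert w S" g']
    by (simp_all add: is_vanishing_kernel_def)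
  define c where "c = g w / g' w"
  let ?d = "\<lambda>y. g y - c * g' y"
  have "g \<in> kspan (insert z (insert w S))" "g' \<in> kspan (insert z (insert w S))"
    using g g' insert.hyps by (auto simp: is_vanishing_kernel_def intro: kspan_mono[rotated 2])
  then have "?d \<in> kspan (insert z (insert w S))" by (rule kspan_diff)
  moreover have "?d w = 0"
  proof (cases "g' w = 0")
    case True
    then have "ip H g' g' = 0" using g' mem by (auto simp: is_vanishing_kernel_def)
    then have "g' = (\<lambda>z. 0)" using ip_definite mem by blast
    then have "ip H g' g = 0"
      using ip_scale_left[OF zero_mem mem(1), of 0] by simp
    then have "ip H g g' = 0" using ip_cnj[OF mem(2,1)] by simp
    then have "g w = 0" using g g' mem by (auto simp: is_vanishing_kernel_def)
    then show ?thesis using True by simp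
  next
    case False
    then show ?thesis by (simp add: c_def)
  qed
  moreover have "ip H f ?d = f z" if "f \<in> fns H" "\<forall>x\<in>insert w S. f x = 0" for f
    using that g g' mem by (simp add: ip_diff_right is_vanishing_kernel_def)
  ultimately show ?case
    using g g' by (intro exI[of _ ?d]) (auto simp: is_vanishing_kernel_def)
qed

definition vanishing_kernel :: "'x set \<Rightarrow> 'x \<Rightarrow> 'x \<Rightarrow> complex" where
  "vanishing_kernel S z = (SOME g. is_vanishing_kernel S z g)"

text \<open>Equivalently, the squared distance from the kernel function at \<open>z\<close> to the span of those at the
  points of \<open>S\<close>.\<close>

definition gap :: "'x set \<Rightarrow> 'x \<Rightarrow> real" where
  "gap S z = (fnorm H (vanishing_kernel S z))\<^sup>2"

lemma gap_nonneg: "0 \<le> gap S z"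
  by (simp add: gap_def)

context
  fixes S z
  assumes S: "finite S" "S \<subseteq> X" and z: "z \<in> X"
begin

lemma
  shows vanishing_kernel_kspan: "vanishing_kernel S z \<in> kspan (insert z S)"
    and vanishing_kernel_zero: "w \<in> S \<Longrightarrow> vanishing_kernel S z w = 0"
    and vanishing_kernel_reproducing:
      "f \<in> fns H \<Longrightarrow> (\<And>w. w \<in> S \<Longrightarrow> f w = 0) \<Longrightarrow> ip H f (vanishing_kernel S z) = f z"
proof -
  have *: "is_vanishing_kernel S z (vanishing_kernel S z)"
    unfolding vanishing_kernel_def by (rule someI_ex[OF vanishing_kernel_exists[OF S z]])
  show "vanishing_kernel S z \<in> kspan (insert z S)"
    using * unfolding is_vanishing_kernel_def by simp
  show "vanishing_kernel S z w = 0" if "w \<in> S" for w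
    using * that unfolding is_vanishing_kernel_def by simp
  show "ip H f (vanishing_kernel S z) = f z" if "f \<in> fns H" "\<And>w. w \<in> S \<Longrightarrow> f w = 0" for f
    using * that unfolding is_vanishing_kernel_def by simp
qed

lemma vanishing_kernel_mem: "vanishing_kernel S z \<in> fns H"
  using S z vanishing_kernel_kspan by (intro kspan_mem[of "insert z S"]) auto

lemma vanishing_kernel_diag: "vanishing_kernel S z z = of_real (gap S z)"
  using vanishing_kernel_reproducing[OF vanishing_kernel_mem vanishing_kernel_zero]
    ip_self[OF vanishing_kernel_mem] by (simp add: gap_def)

lemma norm_eval_le_gap:
  assumes "f \<in> fns H" "\<And>w. w \<in> S \<Longrightarrow> f w = 0"
  shows "(norm (f z))\<^sup>2 \<le> (fnorm H f)\<^sup>2 * gap S z"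
proof -
  have "norm (f z) \<le> fnorm H f * fnorm H (vanishing_kernel S z)"
    using Cauchy_Schwarz[OF assms(1) vanishing_kernel_mem] vanishing_kernel_reproducing[OF assms] by simp
  then have "(norm (f z))\<^sup>2 \<le> (fnorm H f * fnorm H (vanishing_kernel S z))\<^sup>2"
    by (rule power_mono) simp
  then show ?thesis by (simp add: power_mult_distrib gap_def)
qed

text \<open>Pair the combination with \<open>vanishing_kernel S z\<close>: the terms over \<open>S\<close> drop out, so only the
  coefficient at \<open>z\<close> survives, and Cauchy--Schwarz applies.\<close>

lemma gap_mult_norm_le:
  assumes "z \<notin> S"
  shows "gap S z * (norm (a z))\<^sup>2 \<le> (fnorm H (\<lambda>y. \<Sum>x\<in>insert z S. a x * kfun x y))\<^sup>2"
proof -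
  let ?h = "\<lambda>y. \<Sum>x\<in>insert z S. a x * kfun x y" and ?g = "vanishing_kernel S z"
  have kmem: "kfun x \<in> fns H" if "x \<in> insert z S" for x
    using that S z by (intro kfun_mem) auto
  have h: "?h \<in> fns H" using S kmem by (intro sum_mem) auto
  have "ip H ?g ?h = (\<Sum>x\<in>insert z S. cnj (a x) * ip H ?g (kfun x))"
    by (rule ip_sum_right) (use S kmem vanishing_kernel_mem in auto)
  also have "\<dots> = (\<Sum>x\<in>insert z S. cnj (a x) * ?g x)"
    using S z by (intro sum.cong refl) (auto simp: reproducing vanishing_kernel_mem subset_iff)
  also have "\<dots> = cnj (a z) * of_real (gap S z)"
    using S assms by (simp add: vanishing_kernel_zero vanishing_kernel_diag)
  finally have "norm (a z) * gap S z \<le> fnorm H ?g * fnorm H ?h"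
    using Cauchy_Schwarz[OF vanishing_kernel_mem h] gap_nonneg[of S z] by (simp add: norm_mult)
  then have "(norm (a z) * gap S z)\<^sup>2 \<le> (fnorm H ?g * fnorm H ?h)\<^sup>2"
    using gap_nonneg[of S z] by (intro power_mono) auto
  then have "gap S z * (gap S z * (norm (a z))\<^sup>2) \<le> gap S z * (fnorm H ?h)\<^sup>2"
    by (simp add: power_mult_distrib gap_def[symmetric] power2_eq_square[of "gap S z"] mult_ac)
  then show ?thesis
    using gap_nonneg[of S z] by (cases "gap S z = 0") (auto simp: mult_le_cancel_left)
qed

end

lemma gap_empty: "z \<in> X \<Longrightarrow> gap {} z = Re (k z z)"
proof -
  assume z: "z \<in> X"
  let ?g = "vanishing_kernel {} z"
  have "ip H (kfun z) ?g = kfun z z"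
    by (rule vanishing_kernel_reproducing) (use z kfun_mem in auto)
  moreover have "ip H ?g (kfun z) = ?g z"
    by (rule reproducing) (use z vanishing_kernel_mem in auto)
  ultimately have "cnj (?g z) = k z z"
    using ip_cnj[of ?g "kfun z"] z kfun_mem vanishing_kernel_mem by (simp add: kfun_eval)
  then show ?thesis using vanishing_kernel_diag[of "{}" z] z by simp (metis Re_complex_of_real cnj.sel(1))
qed

text \<open>The projection \<open>k\<^sub>z - (k(w,z) / k(w,w)) k\<^sub>w\<close> of \<open>k\<^sub>z\<close> vanishes at \<open>w\<close>, and its value at \<open>z\<close>
  is its squared norm, the left-hand side.\<close>

lemma gap_singleton_ge:
  assumes z: "z \<in> X" and w: "w \<in> X" and pos: "0 < Re (k w w)"
  shows "Re (k z z) - (norm (k z w))\<^sup>2 / Re (k w w) \<le> gap {w} z"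
proof -
  define c where "c = k w z / k w w"
  let ?f = "\<lambda>y. kfun z y - c * kfun w y"
  define d where "d = Re (k z z) - (norm (k z w))\<^sup>2 / Re (k w w)"
  have f: "?f \<in> fns H" using z w by (intro diff_mem kfun_mem)
  have kw: "k w w = of_real (Re (k w w))" using kernel_diagonal w by simp
  have "k w w \<noteq> 0" using pos by auto
  then have fw: "?f w = 0" using w by (simp add: kfun_eval c_def)
  have fz: "?f z = of_real d"
  proof -
    have "c * k z w = of_real ((norm (k z w))\<^sup>2 / Re (k w w))"
      unfolding c_def kernel_hermitian[OF z w] by (subst kw) (simp add: complex_norm_square mult.commute del: of_real_power)
    then show ?thesis
      using kernel_diagonal[OF z] z by (simp add: kfun_eval d_def)
  qed
  have "ip H ?f ?f = ip H ?f (kfun z) - cnj c * ip H ?f (kfun w)"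
    by (rule ip_diff_right[OF kfun_mem[OF z] kfun_mem[OF w] f])
  also have "\<dots> = ?f z"
    unfolding reproducing[OF z f] reproducing[OF w f] fw by simp
  finally have norm: "(fnorm H ?f)\<^sup>2 = d"
    using ip_self[OF f] fz by (metis of_real_eq_iff)
  have "(norm (?f z))\<^sup>2 \<le> (fnorm H ?f)\<^sup>2 * gap {w} z"
    by (rule norm_eval_le_gap) (use z w f fw in auto)
  then have "d * d \<le> d * gap {w} z"
    unfolding norm fz by (simp add: power2_eq_square)
  moreover have "0 \<le> d" using norm by (metis zero_le_power2)
  ultimately show ?thesis
    using gap_nonneg[of "{w}" z] z w unfolding d_def[symmetric]
    by (cases "d = 0") (auto simp: mult_le_cancel_left)
qed

lemma coefficient_bound:
  assumes T: "finite T" "T \<subseteq> X" and x: "x \<in> T"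
    and g: "g = (\<lambda>y. \<Sum>x\<in>T. a x * kfun x y)"
  shows "gap (T - {x}) x * (norm (a x))\<^sup>2 \<le> (fnorm H g)\<^sup>2"
  using gap_mult_norm_le[of "T - {x}" x a] T x by (auto simp: g insert_absorb)

end

section \<open>Adding a zero in a Pick pair\<close>

context rkhs begin

lemma fnorm_kernel_sum:
  assumes "finite A" "A \<subseteq> X"
  shows "of_real ((fnorm H (\<lambda>t. \<Sum>x\<in>A. v x * kfun x t))\<^sup>2) = (\<Sum>x\<in>A. \<Sum>y\<in>A. cnj (v x) * k x y * v y)"
proof -
  let ?h = "\<lambda>t. \<Sum>x\<in>A. v x * kfun x t"
  have mem: "kfun x \<in> fns H" if "x \<in> A" for x using that assms(2) kfun_mem by auto
  have h: "?h \<in> fns H" using assms(1) mem by (rule sum_mem)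
  have "ip H ?h ?h = (\<Sum>x\<in>A. cnj (v x) * ip H ?h (kfun x))"
    using assms(1) mem h by (rule ip_sum_right)
  also have "\<dots> = (\<Sum>x\<in>A. cnj (v x) * (\<Sum>y\<in>A. v y * k x y))"
  proof (intro sum.cong refl arg_cong2[where f = "(*)"])
    fix x assume "x \<in> A"
    then have x: "x \<in> X" using assms(2) by auto
    show "ip H ?h (kfun x) = (\<Sum>y\<in>A. v y * k x y)"
      unfolding reproducing[OF x h] kfun_eval[OF x] ..
  qed
  also have "\<dots> = (\<Sum>x\<in>A. \<Sum>y\<in>A. cnj (v x) * k x y * v y)"
    by (simp add: sum_distrib_left mult_ac)
  finally show ?thesis using ip_self[OF h] by simp
qed

end

definition contractive_multiplier ::
  "'x set \<Rightarrow> 'x function_space \<Rightarrow> 'x function_space \<Rightarrow> ('x \<Rightarrow> complex) \<Rightarrow> bool" where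
  "contractive_multiplier X H K \<phi> \<longleftrightarrow> (\<forall>f\<in>fns H.
     restr X (\<lambda>x. \<phi> x * f x) \<in> fns K \<and> fnorm K (restr X (\<lambda>x. \<phi> x * f x)) \<le> fnorm H f)"

text \<open>Interpolation of scalar data on a finite set of distinct points, with positivity of the Pick
  matrix expressed as a quadratic form.\<close>

locale scalar_Pick_pair =
  H: rkhs X k H + K: rkhs X l K
  for X :: "'x set" and k l :: "'x \<Rightarrow> 'x \<Rightarrow> complex" and H K :: "'x function_space" +
  assumes interpolation: "finite A \<Longrightarrow> A \<noteq> {} \<Longrightarrow> A \<subseteq> X \<Longrightarrow>
    (\<And>v. 0 \<le> (\<Sum>x\<in>A. \<Sum>y\<in>A. cnj (v x) * (l x y - k x y * W x * cnj (W y)) * v y)) \<Longrightarrow>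
    \<exists>\<phi>. (\<forall>x\<in>A. \<phi> x = W x) \<and> contractive_multiplier X H K \<phi>"

lemma tensor_norm_one:
  assumes "hilbert_functions X H" "f \<in> fns H" "\<And>z. F z = vec 1 (\<lambda>_. f z)"
  shows "tensor_norm H 1 F = fnorm H f"
  using hilbert_functions.fnorm_nonneg[OF assms(1,2)] assms(3) by (simp add: tensor_norm_def)

text \<open>The multiplier norm is a supremum over the unit ball, so the estimate for an arbitrary function
  follows by scaling it to norm one; the zero function is treated separately.\<close>

lemma contractive_multiplier_of_Mult:
  assumes H: "hilbert_functions X H" and K: "hilbert_functions X K"
    and \<Phi>: "\<Phi> \<in> Mult X H K 1" "mult_norm X H K 1 \<Phi> \<le> 1"
  shows "contractive_multiplier X H K (\<lambda>x. \<Phi> x $$ (0, 0))"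
  unfolding contractive_multiplier_def
proof (intro ballI)
  interpret H: hilbert_functions X H by (rule H)
  interpret K: hilbert_functions X K by (rule K)
  define P where "P = (\<lambda>f. restr X (\<lambda>x. \<Phi> x $$ (0, 0) * f x))"
  define V where "V = (\<lambda>f (z :: 'a). vec 1 (\<lambda>_. f z :: complex))"
  have dims: "\<Phi> z \<in> carrier_mat 1 1" if "z \<in> X" for z using that \<Phi>(1) by (auto simp: Mult_def)
  have V_mem: "V f \<in> tensor_fns H 1" if "f \<in> fns H" for f
    using that by (auto simp: V_def tensor_fns_def)
  have op: "mult_op X 1 \<Phi> (V f) = V (P f)" for f
  proof
    fix z
    show "mult_op X 1 \<Phi> (V f) z = V (P f) z"
      using dims[of z] by (auto simp: mult_op_def V_def P_def restr_def scalar_prod_def intro!: eq_vecI)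
  qed
  have P_mem: "P f \<in> fns K" if "f \<in> fns H" for f
  proof -
    have "V (P f) \<in> tensor_fns K 1"
      using \<Phi>(1) V_mem[OF that] op[of f] unfolding Mult_def by auto
    then show ?thesis by (simp add: tensor_fns_def V_def)
  qed
  have bound: "fnorm K (P f) \<le> 1" if f: "f \<in> fns H" "fnorm H f \<le> 1" for f
  proof -
    have "tensor_norm H 1 (V f) = fnorm H f"
      by (rule tensor_norm_one[OF H f(1)]) (simp add: V_def)
    then have "V f \<in> {f \<in> tensor_fns H 1. tensor_norm H 1 f \<le> 1}"
      using f V_mem by simp
    then have "ennreal (tensor_norm K 1 (mult_op X 1 \<Phi> (V f))) \<le> mult_norm X H K 1 \<Phi>"
      unfolding mult_norm_def by (rule SUP_upper)
    also have "tensor_norm K 1 (mult_op X 1 \<Phi> (V f)) = fnorm K (P f)"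
      unfolding op by (rule tensor_norm_one[OF K P_mem[OF f(1)]]) (simp add: V_def)
    finally have "ennreal (fnorm K (P f)) \<le> ennreal 1"
      using order_trans[OF _ \<Phi>(2)] by (simp only: ennreal_1)
    then show ?thesis by (subst (asm) ennreal_le_iff) auto
  qed
  have P_scale: "P (\<lambda>x. c * f x) = (\<lambda>x. c * P f x)" for c f
    by (auto simp: P_def restr_def)
  fix f assume f: "f \<in> fns H"
  have "fnorm K (P f) \<le> fnorm H f"
  proof (cases "fnorm H f = 0")
    case True
    then have "f = (\<lambda>z. 0)" using H.fnorm_zero f by simp
    then have "P f = (\<lambda>x. 0 * P f x)" by (auto simp: P_def restr_def)
    then have "fnorm K (P f) = norm (0 :: complex) * fnorm K (P f)"
      using K.fnorm_scale[OF P_mem[OF f], of 0] by simp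
    then show ?thesis using True by simp
  next
    case False
    then have pos: "0 < fnorm H f" using H.fnorm_nonneg[OF f] by simp
    let ?c = "complex_of_real (inverse (fnorm H f))"
    have nc: "norm ?c = inverse (fnorm H f)"
      using pos by (simp only: norm_of_real) simp
    have "fnorm K (P (\<lambda>x. ?c * f x)) \<le> 1"
      by (rule bound[OF H.scale_mem[OF f]]) (use pos nc H.fnorm_scale[OF f, of ?c] in simp)
    then have "inverse (fnorm H f) * fnorm K (P f) \<le> 1"
      unfolding P_scale K.fnorm_scale[OF P_mem[OF f]] nc .
    then show ?thesis using pos by (simp add: field_simps)
  qed
  then show "restr X (\<lambda>x. \<Phi> x $$ (0, 0) * f x) \<in> fns K \<and>
      fnorm K (restr X (\<lambda>x. \<Phi> x $$ (0, 0) * f x)) \<le> fnorm H f"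
    using P_mem[OF f] by (simp add: P_def)
qed

lemma psd_pick_matrix_scalar:
  assumes bij: "bij_betw z {..<n} A"
    and pos: "\<And>v. 0 \<le> (\<Sum>x\<in>A. \<Sum>y\<in>A. cnj (v x) * (l x y - k x y * W x * cnj (W y)) * v y)"
  shows "psd_mat (pick_matrix k l n 1 z (\<lambda>i. mat 1 1 (\<lambda>_. W (z i))))"
proof -
  define P where "P = pick_matrix k l n 1 z (\<lambda>i. mat 1 1 (\<lambda>_. W (z i)))"
  have dim: "dim_row P = n" "dim_col P = n" by (simp_all add: P_def pick_matrix_def)
  have entry: "P $$ (i, j) = l (z i) (z j) - k (z i) (z j) * W (z i) * cnj (W (z j))"
    if "i < n" "j < n" for i j
    using that by (simp add: P_def pick_matrix_def scalar_prod_def mat_adjoint_def mat_of_rows_def Let_def)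
  have "0 \<le> (P *\<^sub>v v) \<bullet>c v" if "v \<in> carrier_vec (dim_row P)" for v
  proof -
    have v: "dim_vec v = n" using that dim by simp
    define u where "u = (\<lambda>x. v $ (inv_into {..<n} z x))"
    have u: "u (z i) = v $ i" if "i < n" for i
      using that bij by (simp add: u_def inv_into_f_f bij_betw_def)
    have "(P *\<^sub>v v) \<bullet>c v = (\<Sum>i<n. (\<Sum>j<n. P $$ (i, j) * v $ j) * cnj (v $ i))"
      using v dim by (simp add: scalar_prod_def lessThan_atLeast0)
    also have "\<dots> = (\<Sum>i<n. \<Sum>j<n. cnj (u (z i)) *
        (l (z i) (z j) - k (z i) (z j) * W (z i) * cnj (W (z j))) * u (z j))"
      by (simp add: entry u sum_distrib_left sum_distrib_right mult_ac)
    also have "\<dots> = (\<Sum>x\<in>A. \<Sum>y\<in>A. cnj (u x) * (l x y - k x y * W x * cnj (W y)) * u y)"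
      by (simp only: sum.reindex_bij_betw[OF bij, of "\<lambda>y. cnj (u x) * (l x y - k x y * W x * cnj (W y)) * u y" for x]
           sum.reindex_bij_betw[OF bij, of "\<lambda>x. \<Sum>y\<in>A. cnj (u x) * (l x y - k x y * W x * cnj (W y)) * u y"])
    finally show ?thesis using pos by simp
  qed
  then show ?thesis
    using dim unfolding P_def[symmetric] psd_mat_def by simp
qed

lemma complete_Pick_pair_imp_scalar:
  assumes "complete_Pick_pair X k l"
  obtains H K where "scalar_Pick_pair X k l H K"
proof -
  obtain H K where H: "is_rkhs X k H" and K: "is_rkhs X l K"
    and pick: "\<And>n N z W. 1 \<le> n \<Longrightarrow> 1 \<le> N \<Longrightarrow> (\<And>i. i < n \<Longrightarrow> z i \<in> X \<and> W i \<in> carrier_mat N N) \<Longrightarrow>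
      psd_mat (pick_matrix k l n N z W) \<Longrightarrow>
      \<exists>\<Phi> \<in> Mult X H K N. mult_norm X H K N \<Phi> \<le> 1 \<and> (\<forall>i<n. \<Phi> (z i) = W i)"
    using assms unfolding complete_Pick_pair_def by metis
  interpret H: rkhs X k H by unfold_locales (rule H)
  interpret K: rkhs X l K by unfold_locales (rule K)
  have "scalar_Pick_pair X k l H K"
  proof unfold_locales
    fix A :: "'a set" and W :: "'a \<Rightarrow> complex"
    assume A: "finite A" "A \<noteq> {}" "A \<subseteq> X"
      and pos: "\<And>v. 0 \<le> (\<Sum>x\<in>A. \<Sum>y\<in>A. cnj (v x) * (l x y - k x y * W x * cnj (W y)) * v y)"
    obtain z where z: "bij_betw z {..<card A} A"
      using ex_bij_betw_nat_finite[OF A(1)] by (auto simp: lessThan_atLeast0)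
    let ?n = "card A"
    have n: "1 \<le> ?n" using A by (simp add: Suc_le_eq card_gt_0_iff)
    have mem: "z i \<in> X \<and> mat 1 1 (\<lambda>_. W (z i)) \<in> carrier_mat 1 1" if "i < ?n" for i
      using that z A(3) by (auto simp: bij_betw_def)
    have "\<exists>\<Phi>\<in>Mult X H K 1. mult_norm X H K 1 \<Phi> \<le> 1 \<and> (\<forall>i<?n. \<Phi> (z i) = mat 1 1 (\<lambda>_. W (z i)))"
      by (rule pick[OF n order_refl mem psd_pick_matrix_scalar[OF z pos]])
    then obtain \<Phi> where \<Phi>: "\<Phi> \<in> Mult X H K 1" "mult_norm X H K 1 \<Phi> \<le> 1"
      "\<forall>i<?n. \<Phi> (z i) = mat 1 1 (\<lambda>_. W (z i))"
      by blast
    have "\<Phi> x $$ (0, 0) = W x" if "x \<in> A" for x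
    proof -
      have "x \<in> z ` {..<?n}" using that z by (simp add: bij_betw_def)
      then obtain i where "i < ?n" "x = z i" by blast
      then show ?thesis using \<Phi>(3) by simp
    qed
    moreover have "contractive_multiplier X H K (\<lambda>x. \<Phi> x $$ (0, 0))"
      by (rule contractive_multiplier_of_Mult[OF _ _ \<Phi>(1,2)])
        (rule H.hilbert_functions_axioms K.hilbert_functions_axioms)+
    ultimately show "\<exists>\<phi>. (\<forall>x\<in>A. \<phi> x = W x) \<and> contractive_multiplier X H K \<phi>"
      by (intro exI[of _ "\<lambda>x. \<Phi> x $$ (0, 0)"] conjI ballI)
  qed
  then show ?thesis by (rule that)
qed

context scalar_Pick_pair begin

text \<open>Choose \<open>a\<close> with \<open>a\<^sup>2 k(z,z)\<close> equal to the gap of \<open>z\<close> over \<open>S\<close>. Then the Pick matrix for the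
  value \<open>a\<close> at \<open>z\<close> and \<open>0\<close> on \<open>S\<close> is positive by \<open>K.gap_mult_norm_le\<close>. If \<open>\<phi>\<close> is a solution and \<open>f\<close> is
  the extremal function for the zero \<open>w\<close>, of squared norm \<open>d = f(z)\<close>, then \<open>\<phi> f\<close> has the zeros
  \<open>S \<union> {w}\<close>, squared norm at most \<open>d\<close>, and the value \<open>a d\<close> at \<open>z\<close>; so the gap over \<open>S \<union> {w}\<close> is at
  least \<open>a\<^sup>2 d\<close>.\<close>

lemma gap_insert_ge:
  assumes S: "finite S" "S \<subseteq> X" and z: "z \<in> X" "z \<notin> S" and w: "w \<in> X" and pos: "0 < Re (k z z)"
  shows "K.gap S z * (H.gap {w} z / Re (k z z)) \<le> K.gap (insert w S) z"
proof -
  define a where "a = sqrt (K.gap S z / Re (k z z))"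
  have gap0: "0 \<le> K.gap S z" by (rule K.gap_nonneg)
  have a: "a\<^sup>2 = K.gap S z / Re (k z z)" using gap0 pos by (simp add: a_def)
  define W where "W = (\<lambda>x. if x = z then complex_of_real a else 0)"
  have "0 \<le> (\<Sum>x\<in>insert z S. \<Sum>y\<in>insert z S. cnj (v x) * (l x y - k x y * W x * cnj (W y)) * v y)" for v
  proof -
    let ?n = "(fnorm K (\<lambda>t. \<Sum>x\<in>insert z S. v x * K.kfun x t))\<^sup>2"
    have "(\<Sum>x\<in>insert z S. \<Sum>y\<in>insert z S. cnj (v x) * (l x y - k x y * W x * cnj (W y)) * v y)
      = (\<Sum>x\<in>insert z S. \<Sum>y\<in>insert z S. cnj (v x) * l x y * v y)
       - (\<Sum>x\<in>insert z S. \<Sum>y\<in>insert z S. cnj (v x) * k x y * W x * cnj (W y) * v y)"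
      by (simp only: sum_subtractf[symmetric]) (simp only: right_diff_distrib left_diff_distrib mult.assoc)
    also have "(\<Sum>x\<in>insert z S. \<Sum>y\<in>insert z S. cnj (v x) * l x y * v y) = of_real ?n"
      by (rule K.fnorm_kernel_sum[symmetric]) (use S z in auto)
    also have "(\<Sum>x\<in>insert z S. \<Sum>y\<in>insert z S. cnj (v x) * k x y * W x * cnj (W y) * v y)
       = (\<Sum>x\<in>insert z S. \<Sum>y\<in>insert z S.
           if y = z then if x = z then cnj (v z) * k z z * (of_real a)\<^sup>2 * v z else 0 else 0)"
      by (intro sum.cong refl) (simp add: W_def power2_eq_square)
    also have "\<dots> = cnj (v z) * k z z * (of_real a)\<^sup>2 * v z"
      using S by simp
    also have "\<dots> = (v z * cnj (v z)) * of_real (Re (k z z)) * of_real (a\<^sup>2)"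
      by (subst H.kernel_diagonal[OF z(1), symmetric]) (simp add: mult_ac)
    also have "\<dots> = of_real ((norm (v z))\<^sup>2 * Re (k z z) * a\<^sup>2)"
      by (simp only: of_real_mult complex_norm_square)
    also have "(norm (v z))\<^sup>2 * Re (k z z) * a\<^sup>2 = K.gap S z * (norm (v z))\<^sup>2"
      using pos by (simp add: a)
    finally show ?thesis
      using K.gap_mult_norm_le[OF S z, of v] by (simp add: less_eq_complex_def del: of_real_power of_real_mult)
  qed
  then obtain \<phi> where \<phi>: "\<And>x. x \<in> insert z S \<Longrightarrow> \<phi> x = W x" "contractive_multiplier X H K \<phi>"
    using interpolation[of "insert z S" W] S z by auto
  define f where "f = H.vanishing_kernel {w} z"
  define d where "d = H.gap {w} z"
  have d0: "0 \<le> d" by (simp add: d_def H.gap_nonneg)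
  have f: "f \<in> fns H" "f w = 0" "f z = of_real d" "(fnorm H f)\<^sup>2 = d"
    using z w by (simp_all add: f_def d_def H.vanishing_kernel_mem H.vanishing_kernel_zero H.vanishing_kernel_diag H.gap_def)
  define g where "g = restr X (\<lambda>x. \<phi> x * f x)"
  have g: "g \<in> fns K" "fnorm K g \<le> fnorm H f"
    using \<phi>(2) f(1) by (auto simp: contractive_multiplier_def g_def)
  have "g x = 0" if "x \<in> insert w S" for x
    using that \<phi>(1)[of x] f(2) z(2) by (auto simp: g_def restr_def W_def)
  then have "(norm (g z))\<^sup>2 \<le> (fnorm K g)\<^sup>2 * K.gap (insert w S) z"
    using S z w g(1) by (intro K.norm_eval_le_gap) auto
  also have "\<dots> \<le> d * K.gap (insert w S) z"
  proof (rule mult_right_mono)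
    show "(fnorm K g)\<^sup>2 \<le> d"
      using power_mono[OF g(2) K.fnorm_nonneg[OF g(1)], of 2] f(4) by simp
    show "0 \<le> K.gap (insert w S) z" by (rule K.gap_nonneg)
  qed
  also have "(norm (g z))\<^sup>2 = d * (a\<^sup>2 * d)"
  proof -
    have "g z = of_real (a * d)"
      using z \<phi>(1)[of z] f(3) by (simp add: g_def restr_def W_def)
    then show ?thesis by (simp only: norm_of_real power2_abs) (simp add: power2_eq_square)
  qed
  finally have le: "d * (a\<^sup>2 * d) \<le> d * K.gap (insert w S) z" .
  have "a\<^sup>2 * d \<le> K.gap (insert w S) z"
  proof (cases "d = 0")
    case True
    then show ?thesis using K.gap_nonneg[of "insert w S" z] S z w by simp
  next
    case False
    then show ?thesis using le d0 by (simp add: mult_le_cancel_left)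
  qed
  then show ?thesis by (simp add: a d_def)
qed

lemma gap_ge_prod:
  assumes "finite S" "S \<subseteq> X" and z: "z \<in> X" "z \<notin> S" and pos: "0 < Re (k z z)"
  shows "Re (l z z) * (\<Prod>w\<in>S. H.gap {w} z / Re (k z z)) \<le> K.gap S z"
  using assms(1,2) z(2)
proof (induction S rule: finite_induct)
  case empty
  then show ?case using K.gap_empty[OF z(1)] by simp
next
  case (insert w S)
  have "0 \<le> H.gap {w} z" by (rule H.gap_nonneg)
  then have "(H.gap {w} z / Re (k z z)) * (Re (l z z) * (\<Prod>w\<in>S. H.gap {w} z / Re (k z z)))
      \<le> (H.gap {w} z / Re (k z z)) * K.gap S z"
    using insert pos by (intro mult_left_mono) auto
  also have "\<dots> \<le> K.gap (insert w S) z"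
    using gap_insert_ge[of S z w] insert z pos by (simp add: mult.commute)
  finally show ?case using insert.hyps by (simp add: mult_ac)
qed

end

section \<open>Exponentially separated points\<close>

lemma power_self_le_exp_mult_fact: "real m ^ m \<le> exp (real m) * fact m"
proof -
  have s: "summable (\<lambda>n. real m ^ n /\<^sub>R fact n)" by (rule summable_exp_generic)
  have "(\<Sum>n\<in>{m}. real m ^ n /\<^sub>R fact n) \<le> (\<Sum>n. real m ^ n /\<^sub>R fact n)"
    by (rule sum_le_suminf[OF s]) auto
  then show ?thesis by (simp add: exp_def field_simps)
qed

lemma prod_differences_eq_facts:
  assumes "i \<le> m"
  shows "(\<Prod>j\<in>{..m} - {i}. \<bar>real i - real j\<bar>) = fact i * fact (m - i)"
proof -
  have "(\<Prod>j\<in>{..<i}. \<bar>real i - real j\<bar>) = (\<Prod>d\<in>{1..i}. real d)"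
    by (rule prod.reindex_bij_witness[of _ "\<lambda>d. i - d" "\<lambda>j. i - j"]) (auto simp: of_nat_diff)
  moreover have "(\<Prod>j\<in>{i<..m}. \<bar>real i - real j\<bar>) = (\<Prod>d\<in>{1..m - i}. real d)"
    using assms by (intro prod.reindex_bij_witness[of _ "\<lambda>d. i + d" "\<lambda>j. j - i"]) (auto simp: of_nat_diff)
  moreover have split: "{..m} - {i} = {..<i} \<union> {i<..m}" using assms by auto
  have "(\<Prod>j\<in>{..m} - {i}. \<bar>real i - real j\<bar>) =
      (\<Prod>j\<in>{..<i}. \<bar>real i - real j\<bar>) * (\<Prod>j\<in>{i<..m}. \<bar>real i - real j\<bar>)"
    unfolding split by (rule prod.union_disjoint) auto
  ultimately show ?thesis by (simp add: fact_prod)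
qed

text \<open>Equidistant points on a segment of length \<open>\<eta>\<close> starting at \<open>p\<close>. The distances from the \<open>i\<close>-th of
  them multiply to \<open>(\<eta>/m)\<^sup>m i! (m-i)!\<close>, and \<open>i! (m-i)! \<ge> m! / 2\<^sup>m \<ge> (m / 2e)\<^sup>m\<close>.\<close>

lemma exists_separated_points:
  fixes p :: complex
  assumes \<eta>: "0 < \<eta>"
  shows "\<exists>S. finite S \<and> card S = m \<and> S \<subseteq> cball p \<eta> - {p} \<and>
    (\<forall>x\<in>insert p S. (\<eta> / (2 * exp 1)) ^ m \<le> (\<Prod>w\<in>insert p S - {x}. norm (x - w)))"
proof (cases "m = 0")
  case True
  then show ?thesis by (intro exI[of _ "{}"]) auto
next
  case False
  define q where "q = (\<lambda>j::nat. p + of_real (\<eta> * real j / real m))"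
  have dist: "norm (q i - q j) = \<eta> / real m * \<bar>real i - real j\<bar>" for i j
  proof -
    have "q i - q j = of_real (\<eta> / real m * (real i - real j))"
      by (simp add: q_def algebra_simps diff_divide_distrib)
    then show ?thesis using \<eta> by (simp only: norm_of_real) (simp add: abs_mult)
  qed
  have inj: "inj_on q A" for A
  proof (rule inj_onI)
    fix i j assume "q i = q j"
    then have "\<eta> / real m * \<bar>real i - real j\<bar> = 0" using dist[of i j] by simp
    then show "i = j" using \<eta> False by simp
  qed
  have q0: "q 0 = p" by (simp add: q_def)
  have ins: "insert p (q ` {1..m}) = q ` {..m}"
  proof -
    have "{..m} = insert 0 {1..m}" by auto
    then show ?thesis by (simp only: image_insert q0)
  qed
  have "(\<eta> / (2 * exp 1)) ^ m \<le> (\<Prod>w\<in>q ` {..m} - {q i}. norm (q i - w))" if i: "i \<le> m" for i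
  proof -
    have "real (fact i * fact (m - i) * (m choose i)) = real (fact m)"
      using binomial_fact_lemma[OF i] by simp
    moreover have "real (m choose i) \<le> 2 ^ m"
    proof -
      have "(m choose i) \<le> (\<Sum>k\<le>m. m choose k)"
        by (rule member_le_sum) (use i in auto)
      then have "real (m choose i) \<le> real (2 ^ m)" by (simp only: choose_row_sum of_nat_le_iff)
      then show ?thesis by simp
    qed
    ultimately have "fact m \<le> fact i * fact (m - i) * (2 :: real) ^ m"
      by (metis mult_left_mono of_nat_0_le_iff of_nat_fact of_nat_mult)
    then have "exp (real m) * fact m \<le> exp (real m) * (fact i * fact (m - i) * (2 :: real) ^ m)"
      by (rule mult_left_mono) simp
    then have "real m ^ m \<le> exp (real m) * (fact i * fact (m - i) * (2 :: real) ^ m)"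
      by (rule order_trans[OF power_self_le_exp_mult_fact])
    moreover have "exp (real m) = exp 1 ^ m" by (simp add: exp_of_nat_mult[symmetric])
    ultimately have "real m ^ m \<le> (2 * exp 1) ^ m * (fact i * fact (m - i))"
      by (simp add: power_mult_distrib mult_ac)
    then have "1 / (2 * exp 1) ^ m \<le> (1 / real m) ^ m * (fact i * fact (m - i))"
      using False by (simp add: field_simps)
    then have "\<eta> ^ m * (1 / (2 * exp 1) ^ m) \<le> \<eta> ^ m * ((1 / real m) ^ m * (fact i * fact (m - i)))"
      by (rule mult_left_mono) (use \<eta> in simp)
    then have "(\<eta> / (2 * exp 1)) ^ m \<le> (\<eta> / real m) ^ m * (fact i * fact (m - i))"
      by (simp add: power_divide)
    also have "\<dots> = (\<Prod>j\<in>{..m} - {i}. \<eta> / real m * \<bar>real i - real j\<bar>)"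
      using i by (simp only: prod.distrib prod_differences_eq_facts prod_constant) simp
    also have "\<dots> = (\<Prod>j\<in>{..m} - {i}. norm (q i - q j))"
      by (simp only: dist)
    also have "\<dots> = (\<Prod>w\<in>q ` ({..m} - {i}). norm (q i - w))"
      by (subst prod.reindex[OF inj]) simp
    also have "q ` ({..m} - {i}) = q ` {..m} - {q i}"
      using inj_on_image_set_diff[OF inj, of "{..m}" "{i}"] i by auto
    finally show ?thesis .
  qed
  then have "\<forall>x\<in>insert p (q ` {1..m}). (\<eta> / (2 * exp 1)) ^ m
      \<le> (\<Prod>w\<in>insert p (q ` {1..m}) - {x}. norm (x - w))"
    unfolding ins by auto
  moreover have "q ` {1..m} \<subseteq> cball p \<eta> - {p}"
  proof
    fix x assume "x \<in> q ` {1..m}"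
    then obtain j where j: "1 \<le> j" "j \<le> m" "x = q j" by auto
    have "dist p x = \<eta> * (real j / real m)"
      using dist[of 0 j] by (simp add: j(3) q0 dist_norm)
    moreover have "\<eta> * (real j / real m) \<le> \<eta> * 1"
      using j False \<eta> by (intro mult_left_mono) auto
    ultimately show "x \<in> cball p \<eta> - {p}" using j False \<eta> by auto
  qed
  moreover have "card (q ` {1..m}) = m" by (simp add: card_image inj)
  ultimately show ?thesis by (intro exI[of _ "q ` {1..m}"]) auto
qed

section \<open>Separation of points by the Bergman kernel\<close>

text \<open>The factor by which the gap of \<open>z\<close> may shrink when \<open>w\<close> is added to the zeros. With the
  pseudo-hyperbolic distance \<open>\<rho>\<close> of \<open>z\<close> and \<open>w\<close> it equals \<open>1 - (1 - \<rho>\<^sup>2)\<^sup>2 = 2 \<rho>\<^sup>2 - \<rho>\<^sup>4\<close>.\<close>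

definition bergman_separation :: "complex \<Rightarrow> complex \<Rightarrow> real" where
  "bergman_separation z w =
     1 - (norm (bergman_kernel z w))\<^sup>2 / (Re (bergman_kernel z z) * Re (bergman_kernel w w))"

lemma bergman_diag: "bergman_kernel z z = of_real (1 / (1 - (norm z)\<^sup>2)\<^sup>2)"
proof -
  have "z * cnj z = of_real ((norm z)\<^sup>2)" by (rule complex_norm_square[symmetric])
  then show ?thesis by (simp add: bergman_kernel_def)
qed

lemma bergman_diag_pos: "norm z < 1 \<Longrightarrow> 0 < Re (bergman_kernel z z)"
  using power_strict_mono[of "norm z" 1 2] unfolding bergman_diag by (simp only: Re_complex_of_real) simp

lemma norm_one_minus_mult_cnj:
  "(norm (1 - z * cnj w))\<^sup>2 = (1 - (norm z)\<^sup>2) * (1 - (norm w)\<^sup>2) + (norm (z - w))\<^sup>2"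
  unfolding cmod_power2 by (simp add: power2_eq_square algebra_simps)

text \<open>The source of the constant 2. With \<open>n = \<bar>1 - z w\<^sup>*\<bar>\<^sup>2\<close> and
  \<open>P = (1 - \<bar>z\<bar>\<^sup>2)(1 - \<bar>w\<bar>\<^sup>2)\<close>, the separation is \<open>1 - (P/n)\<^sup>2 = (n - P)(n + P)/n\<^sup>2\<close>, where
  the square comes from the exponent of the Bergman kernel; moreover \<open>n - P = \<bar>z - w\<bar>\<^sup>2\<close>, and
  \<open>n\<close> and \<open>P\<close> are close to \<open>1\<close> near the origin.\<close>

lemma bergman_separation_ge:
  assumes "\<mu> < 2"
  obtains t where "0 < t" "t \<le> 1"
    "\<And>z w. norm z < t \<Longrightarrow> norm w < t \<Longrightarrow> \<mu> * (norm (z - w))\<^sup>2 \<le> bergman_separation z w"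
proof -
  let ?\<tau> = "\<lambda>t::real. 1 / (1 + t\<^sup>2)\<^sup>2 + (1 - t\<^sup>2)\<^sup>2 / (1 + t\<^sup>2) ^ 4"
  have "(?\<tau> \<longlongrightarrow> 2) (at_right 0)"
    by (auto intro!: tendsto_eq_intros)
  then have "\<forall>\<^sub>F t in at_right 0. \<mu> < ?\<tau> t"
    using assms by (rule order_tendstoD)
  then obtain b where b: "0 < b" "\<And>t. 0 < t \<Longrightarrow> t < b \<Longrightarrow> \<mu> < ?\<tau> t"
    by (auto simp: eventually_at_right_field)
  define t where "t = min (b / 2) (1 / 2)"
  have t: "0 < t" "t < 1" "\<mu> < ?\<tau> t" using b by (auto simp: t_def)
  have "\<mu> * (norm (z - w))\<^sup>2 \<le> bergman_separation z w" if zw: "norm z < t" "norm w < t" for z w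
  proof -
    define n where "n = (norm (1 - z * cnj w))\<^sup>2"
    define P where "P = (1 - (norm z)\<^sup>2) * (1 - (norm w)\<^sup>2)"
    define d where "d = (norm (z - w))\<^sup>2"
    have sq: "(norm z)\<^sup>2 \<le> t\<^sup>2" "(norm w)\<^sup>2 \<le> t\<^sup>2" "t\<^sup>2 < 1"
      using zw t by (auto intro!: power_mono simp: power_less_one_iff)
    have P: "(1 - t\<^sup>2)\<^sup>2 \<le> P"
      unfolding P_def power2_eq_square[of "1 - t\<^sup>2"] using sq by (intro mult_mono) auto
    have P0: "0 < P" unfolding P_def using sq by (intro mult_pos_pos) auto
    have nPd: "n = P + d" unfolding n_def P_def d_def by (rule norm_one_minus_mult_cnj)
    have d0: "0 \<le> d" by (simp add: d_def)
    have n0: "0 < n" using nPd P0 d0 by simp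
    have "norm (1 - z * cnj w) \<le> 1 + norm z * norm w"
      using norm_triangle_ineq4[of 1 "z * cnj w"] by (simp add: norm_mult)
    also have "norm z * norm w \<le> t * t" using zw t by (intro mult_mono) auto
    finally have n: "n \<le> (1 + t\<^sup>2)\<^sup>2"
      unfolding n_def by (intro power_mono) (auto simp: power2_eq_square)
    have sep: "bergman_separation z w = 1 - P\<^sup>2 / n\<^sup>2"
      unfolding bergman_separation_def bergman_diag Re_complex_of_real
      by (simp add: bergman_kernel_def P_def n_def norm_divide norm_power power_mult_distrib power_divide)
    also have "\<dots> = d * (1 / n + P / n\<^sup>2)"
    proof -
      have P_eq: "P = n - d" using nPd by simp
      show ?thesis unfolding P_eq using n0 by (simp add: field_simps power2_eq_square)
    qed
    finally have sep': "bergman_separation z w = d * (1 / n + P / n\<^sup>2)" .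
    have "?\<tau> t \<le> 1 / n + P / n\<^sup>2"
    proof (rule add_mono)
      show "1 / (1 + t\<^sup>2)\<^sup>2 \<le> 1 / n" using n n0 by (intro frac_le) auto
      have "n\<^sup>2 \<le> ((1 + t\<^sup>2)\<^sup>2)\<^sup>2" using n n0 by (intro power_mono) auto
      then have "n\<^sup>2 \<le> (1 + t\<^sup>2) ^ 4" by (simp flip: power_mult)
      then show "(1 - t\<^sup>2)\<^sup>2 / (1 + t\<^sup>2) ^ 4 \<le> P / n\<^sup>2"
        using P n0 P0 by (intro frac_le) auto
    qed
    then have "d * \<mu> \<le> d * (1 / n + P / n\<^sup>2)"
      using t d0 by (intro mult_left_mono) auto
    then show ?thesis by (simp add: sep' d_def mult.commute)
  qed
  then show ?thesis using that[of t] t by auto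
qed

section \<open>The radius bound\<close>

text \<open>This estimates a vanishing kernel function where the kernel diagonal is not under control. Its
  coefficient at \<open>x\<close> is bounded by the ratio of its norm to the square root of the gap of \<open>x\<close> over the remaining points,
  so lower bounds for the gaps bound all coefficients.\<close>

lemma (in rkhs) vanishing_kernel_bound:
  assumes T: "finite T" "T \<subseteq> X" "z \<in> T" and y: "y \<in> X"
    and M: "\<And>x. x \<in> T \<Longrightarrow> norm (k y x) \<le> M"
    and q: "0 < q" "\<And>x. x \<in> T \<Longrightarrow> q\<^sup>2 \<le> gap (T - {x}) x"
  shows "norm (vanishing_kernel (T - {z}) z y) * q \<le> real (card T) * M * sqrt (gap (T - {z}) z)"
proof -
  let ?g = "vanishing_kernel (T - {z}) z" and ?s = "sqrt (gap (T - {z}) z)"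
  have "?g \<in> kspan T"
    using vanishing_kernel_kspan[of "T - {z}" z] T by (auto simp: insert_absorb)
  then obtain a where g: "?g = (\<lambda>t. \<Sum>x\<in>T. a x * kfun x t)" by (auto simp: kspan_def)
  have a: "norm (a x) * q \<le> ?s" if x: "x \<in> T" for x
  proof -
    have "(norm (a x) * q)\<^sup>2 \<le> gap (T - {x}) x * (norm (a x))\<^sup>2"
      using mult_right_mono[OF q(2)[OF x], of "(norm (a x))\<^sup>2"] by (simp add: power_mult_distrib mult.commute)
    also have "\<dots> \<le> gap (T - {z}) z"
      using coefficient_bound[OF T(1,2) x g] by (simp add: gap_def)
    finally show ?thesis by (rule real_le_rsqrt)
  qed
  have "norm (?g y) * q \<le> (\<Sum>x\<in>T. norm (a x * k y x)) * q"
    unfolding g kfun_eval[OF y] using q(1) by (intro mult_right_mono norm_sum) auto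
  also have "\<dots> = (\<Sum>x\<in>T. norm (k y x) * (norm (a x) * q))"
    by (simp add: sum_distrib_left sum_distrib_right norm_mult mult_ac)
  also have "\<dots> \<le> (\<Sum>x\<in>T. M * ?s)"
  proof (rule sum_mono)
    fix x assume x: "x \<in> T"
    have "0 \<le> M" by (rule order_trans[OF norm_ge_zero M[OF x]])
    then show "norm (k y x) * (norm (a x) * q) \<le> M * ?s"
      using M[OF x] a[OF x] q(1) by (intro mult_mono) auto
  qed
  finally show ?thesis by (simp add: mult.assoc)
qed

lemma bergman_gap_ge:
  assumes pick: "scalar_Pick_pair X bergman_kernel l H K" and X: "X \<subseteq> ball 0 1"
    and S: "finite S" "S \<subseteq> X" and z: "z \<in> X" "z \<notin> S"
    and \<mu>: "0 \<le> \<mu>" "\<And>w. w \<in> S \<Longrightarrow> \<mu> * (norm (z - w))\<^sup>2 \<le> bergman_separation z w"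
  shows "Re (l z z) * \<mu> ^ card S * (\<Prod>w\<in>S. norm (z - w))\<^sup>2 \<le> rkhs.gap X l K S z"
proof -
  interpret scalar_Pick_pair X bergman_kernel l H K by (rule pick)
  have pos: "0 < Re (bergman_kernel w w)" if "w \<in> X" for w
    using that X by (intro bergman_diag_pos) auto
  have "\<mu> ^ card S * (\<Prod>w\<in>S. norm (z - w))\<^sup>2 = (\<Prod>w\<in>S. \<mu> * (norm (z - w))\<^sup>2)"
    by (simp add: prod.distrib prod_power_distrib)
  also have "\<dots> \<le> (\<Prod>w\<in>S. H.gap {w} z / Re (bergman_kernel z z))"
  proof (intro prod_mono conjI)
    fix w assume w: "w \<in> S"
    then have wX: "w \<in> X" using S by auto
    have "bergman_separation z w = (Re (bergman_kernel z z)
        - (norm (bergman_kernel z w))\<^sup>2 / Re (bergman_kernel w w)) / Re (bergman_kernel z z)"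
      using pos[OF z(1)] pos[OF wX] by (simp add: bergman_separation_def field_simps)
    also have "\<dots> \<le> H.gap {w} z / Re (bergman_kernel z z)"
      using H.gap_singleton_ge[OF z(1) wX pos[OF wX]] pos[OF z(1)] by (intro divide_right_mono) auto
    finally show "\<mu> * (norm (z - w))\<^sup>2 \<le> H.gap {w} z / Re (bergman_kernel z z)"
      using \<mu>(2)[OF w] by simp
  qed (use \<mu>(1) in simp)
  finally have "Re (l z z) * (\<mu> ^ card S * (\<Prod>w\<in>S. norm (z - w))\<^sup>2)
      \<le> Re (l z z) * (\<Prod>w\<in>S. H.gap {w} z / Re (bergman_kernel z z))"
    using K.kernel_diagonal_nonneg[OF z(1)] by (rule mult_left_mono)
  also have "\<dots> \<le> K.gap S z"
    using gap_ge_prod[OF S z pos[OF z(1)]] .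
  finally show ?thesis by (simp add: mult.assoc)
qed

theorem theorem8p7:
  fixes r :: real and l :: "complex \<Rightarrow> complex \<Rightarrow> complex"
  assumes "0 < r" and "r \<le> 1"
    and "regular_kernel (ball 0 r) l"
    and "complete_Pick_pair (ball 0 r) bergman_kernel l"
  shows "r \<le> 1 / sqrt 2"
proof (rule ccontr)
  let ?X = "ball (0::complex) r"
  assume "\<not> r \<le> 1 / sqrt 2"
  (* If 2 r^2 > 1, there are \<rho>' < \<rho> < r and \<mu> < 2 with \<mu> \<rho>'^2 > 1. The comparison of the two bounds for
     the gaps will show that sqrt \<mu> * \<rho>' is at most 1. *)
  then obtain \<rho> where \<rho>: "1 / sqrt 2 < \<rho>" "\<rho> < r" using dense[of "1 / sqrt 2" r] by auto
  then obtain \<rho>' where \<rho>': "1 / sqrt 2 < \<rho>'" "\<rho>' < \<rho>" using dense[of "1 / sqrt 2" \<rho>] by auto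
  have \<rho>'0: "0 < \<rho>'" using \<rho>'(1) by (rule less_trans[rotated]) simp
  have "(1 / sqrt 2)\<^sup>2 < \<rho>'\<^sup>2" using \<rho>'(1) by (rule power_strict_mono) auto
  then have "1 / \<rho>'\<^sup>2 < 2" using \<rho>'0 by (simp add: power_divide field_simps)
  then obtain \<mu> where \<mu>: "1 / \<rho>'\<^sup>2 < \<mu>" "\<mu> < 2" using dense by blast
  have "\<rho>'\<^sup>2 \<le> 1" using \<rho>' \<rho> assms(2) \<rho>'0 by (simp add: power_le_one)
  then have "1 \<le> 1 / \<rho>'\<^sup>2" using \<rho>'0 by (simp add: field_simps)
  then have \<mu>1: "1 \<le> \<mu>" using \<mu> by simp
  have \<mu>\<rho>: "1 < \<mu> * \<rho>'\<^sup>2" using \<mu>(1) \<rho>'0 by (simp add: field_simps)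
  obtain H K where pick: "scalar_Pick_pair ?X bergman_kernel l H K"
    using complete_Pick_pair_imp_scalar[OF assms(4)] .
  interpret scalar_Pick_pair ?X bergman_kernel l H K by (rule pick)
  have hol1: "(\<lambda>z. l z w) holomorphic_on ?X" if "w \<in> ?X" for w
    using assms(3) that by (simp add: regular_kernel_def holomorphic_kernel_def)
  have cont2: "continuous_on ?X (\<lambda>w. l z w)" if "z \<in> ?X" for z
  proof -
    have "(\<lambda>w. cnj (l z w)) holomorphic_on ?X"
      using assms(3) that by (simp add: regular_kernel_def holomorphic_kernel_def)
    then have "continuous_on ?X (\<lambda>w. cnj (cnj (l z w)))"
      by (intro continuous_on_cnj holomorphic_on_imp_continuous_on)
    then show ?thesis by simp
  qed
  obtain \<delta> where \<delta>: "0 < \<delta>" and indep: "\<And>A a w. finite A \<Longrightarrow> A \<subseteq> ?X \<inter> ball 0 \<delta> \<Longrightarrow>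
      (\<And>z. z \<in> ?X \<Longrightarrow> (\<Sum>w\<in>A. a w * l z w) = 0) \<Longrightarrow> w \<in> A \<Longrightarrow> a w = (0 :: complex)"
    using assms(3) unfolding regular_kernel_def by meson
  obtain t where t: "0 < t" "t \<le> 1"
    "\<And>z w. norm z < t \<Longrightarrow> norm w < t \<Longrightarrow> \<mu> * (norm (z - w))\<^sup>2 \<le> bergman_separation z w"
    using bergman_separation_ge[OF \<mu>(2)] by metis
  (* All interpolation points lie in the disc of radius s: there the Bergman estimate holds, the
     kernel functions are independent, and circles of radius \<rho> about its points stay in the disc
     of radius R < r. *)
  define s where "s = min (min t \<delta>) (r - \<rho>) / 2"
  have s: "0 < s" "s < t" "s < \<delta>" "2 * s \<le> r - \<rho>" "s < r"
    using t(1) \<delta> \<rho> \<rho>'0 \<rho>' by (auto simp: s_def)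
  define R where "R = (\<rho> + r) / 2"
  have "\<exists>p \<epsilon> M. 0 < \<epsilon> \<and> ball p \<epsilon> \<subseteq> ball (0::complex) s \<and>
      (\<forall>x\<in>ball p \<epsilon>. \<forall>y\<in>cball 0 R. norm (l y x) \<le> M)"
  proof -
    have "R < r" using \<rho> by (simp add: R_def)
    show ?thesis
    proof (rule exists_ball_of_uniform_bound[of s "cball 0 R" 0 "\<lambda>x y. l y x"])
      fix y :: complex assume "y \<in> cball 0 R"
      then show "continuous_on (cball 0 s) (\<lambda>x. l y x)"
        using s \<open>R < r\<close> by (intro continuous_on_subset[OF cont2]) auto
    next
      fix x :: complex assume "x \<in> cball 0 s"
      then have "continuous_on (cball 0 R) (\<lambda>y. l y x)"
        using s \<open>R < r\<close> by (intro continuous_on_subset[OF holomorphic_on_imp_continuous_on[OF hol1]]) auto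
      then show "bounded ((\<lambda>y. l y x) ` cball 0 R)"
        by (intro compact_imp_bounded compact_continuous_image) auto
    qed (use s in blast)+
  qed
  then obtain p \<epsilon> M where p: "0 < \<epsilon>" "ball p \<epsilon> \<subseteq> ball 0 s"
    and M: "\<And>x y. x \<in> ball p \<epsilon> \<Longrightarrow> y \<in> cball 0 R \<Longrightarrow> norm (l y x) \<le> M"
    by blast
  have ps: "norm p < s" using p by (auto simp: subset_iff)
  then have pX: "p \<in> ?X" using s by simp
  have M0: "0 \<le> M"
    using M[of p 0] p(1) \<rho>(2) \<rho>'0 \<rho>'(2) by (force simp: R_def intro: order_trans[OF norm_ge_zero])
  (* The diagonal of the kernel is positive at p, because kernel functions do not vanish there, and
     it stays above c near p: by Cauchy-Schwarz |l(p,x)|^2 \<le> l(x,x) l(p,p), and l(p,x) is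
     continuous in x. *)
  define c where "c = Re (l p p) / 4"
  have c: "0 < c"
  proof (rule ccontr)
    assume "\<not> 0 < c"
    then have 0: "Re (l p p) = 0" using K.kernel_diagonal_nonneg[OF pX] by (simp add: c_def)
    have "l z p = 0" if "z \<in> ?X" for z
      using K.norm_eval_le[OF K.kfun_mem[OF pX] that] K.fnorm_kfun[OF pX] 0 K.kfun_eval[OF that] by simp
    then have "(1 :: complex) = 0"
      using indep[of "{p}" "\<lambda>_. 1" p] pX ps s by simp
    then show False by simp
  qed
  have "\<exists>\<epsilon>'>0. \<forall>x\<in>ball p \<epsilon>'. x \<in> ?X \<longrightarrow> c \<le> Re (l x x)"
  proof -
    obtain \<epsilon>' where \<epsilon>': "0 < \<epsilon>'" "\<And>x. x \<in> ?X \<Longrightarrow> dist x p < \<epsilon>' \<Longrightarrow> dist (l p x) (l p p) < 2 * c"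
      using cont2[OF pX] pX c unfolding continuous_on_iff by (metis mult_pos_pos zero_less_numeral)
    have "c \<le> Re (l x x)" if x: "x \<in> ball p \<epsilon>'" "x \<in> ?X" for x
    proof -
      have "dist (l p x) (l p p) < 2 * c" using \<epsilon>'(2)[of x] x by (simp add: dist_commute[of x p])
      moreover have "4 * c \<le> norm (l p p)" using complex_Re_le_cmod[of "l p p"] by (simp add: c_def)
      ultimately have "2 * c \<le> norm (l p x)"
        using norm_triangle_ineq2[of "l p p" "l p x"] by (simp add: dist_norm norm_minus_commute)
      then have "(2 * c)\<^sup>2 \<le> (norm (l p x))\<^sup>2" using c by (intro power_mono) auto
      also have "\<dots> \<le> Re (l x x) * Re (l p p)"
        using K.norm_eval_le[OF K.kfun_mem[OF x(2)] pX] K.fnorm_kfun[OF x(2)] K.kfun_eval[OF pX] by simp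
      finally have "(4 * c) * c \<le> (4 * c) * Re (l x x)"
        by (simp add: c_def power2_eq_square mult_ac)
      then show ?thesis using c by (simp add: mult_le_cancel_left)
    qed
    then show ?thesis using \<epsilon>'(1) by blast
  qed
  then obtain \<epsilon>' where \<epsilon>': "0 < \<epsilon>'" "\<And>x. x \<in> ball p \<epsilon>' \<Longrightarrow> x \<in> ?X \<Longrightarrow> c \<le> Re (l x x)"
    by blast
  (* The points stay within e of p, so on the circle the product of the distances to the zeros is at
     least (\<rho> - e)^m; the room between \<rho>' and \<rho> absorbs this loss. *)
  define e where "e = min (min \<epsilon> \<epsilon>') (\<rho> - \<rho>')"
  have e: "0 < e" "e \<le> \<epsilon>" "e \<le> \<epsilon>'" "\<rho>' \<le> \<rho> - e" using p \<epsilon>' \<rho>' by (auto simp: e_def)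
  have in_e: "x \<in> ?X \<and> norm x < t \<and> c \<le> Re (l x x) \<and> x \<in> ball p \<epsilon>" if "x \<in> ball p e" for x
  proof -
    have x: "x \<in> ball p \<epsilon>" "x \<in> ball p \<epsilon>'" using that e by auto
    then have "norm x < s" using p by auto
    then show ?thesis using x s \<epsilon>'(2)[OF x(2)] by auto
  qed
  define \<beta> where "\<beta> = e / 2 / (2 * exp 1)"
  have \<beta>: "0 < \<beta>" using e by (simp add: \<beta>_def)
  have "\<forall>m. \<exists>S. finite S \<and> card S = m \<and> S \<subseteq> cball p (e / 2) - {p} \<and>
      (\<forall>x\<in>insert p S. \<beta> ^ m \<le> (\<Prod>w\<in>insert p S - {x}. norm (x - w)))"
    using exists_separated_points[of "e / 2"] e unfolding \<beta>_def by simp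
  then obtain S where "\<forall>m. finite (S m) \<and> card (S m) = m \<and> S m \<subseteq> cball p (e / 2) - {p} \<and>
      (\<forall>x\<in>insert p (S m). \<beta> ^ m \<le> (\<Prod>w\<in>insert p (S m) - {x}. norm (x - w)))"
    by (rule choice[THEN exE])
  then have S: "finite (S m)" "card (S m) = m" "S m \<subseteq> cball p (e / 2) - {p}"
      "\<And>x. x \<in> insert p (S m) \<Longrightarrow> \<beta> ^ m \<le> (\<Prod>w\<in>insert p (S m) - {x}. norm (x - w))" for m
    by blast+
  have S_e: "insert p (S m) \<subseteq> ball p e" for m
  proof
    fix x assume "x \<in> insert p (S m)"
    then have "dist p x \<le> e / 2" using S(3)[of m] e(1) by auto
    then show "x \<in> ball p e" using e(1) by simp
  qed
  have SX: "insert p (S m) \<subseteq> ?X" for m using S_e in_e by blast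
  have pS: "p \<notin> S m" for m using S(3)[of m] by auto
  have gap: "c * \<mu> ^ m * (\<Prod>w\<in>insert p (S m) - {x}. norm (x - w))\<^sup>2 \<le> K.gap (insert p (S m) - {x}) x"
    if x: "x \<in> insert p (S m)" for x m
  proof -
    let ?T = "insert p (S m)"
    have "card (?T - {x}) = m" using x S(1,2)[of m] pS[of m] by simp
    moreover have "Re (l x x) * \<mu> ^ card (?T - {x}) * (\<Prod>w\<in>?T - {x}. norm (x - w))\<^sup>2 \<le> K.gap (?T - {x}) x"
    proof (rule bergman_gap_ge[OF pick])
      show "?X \<subseteq> ball 0 1" using assms(2) by auto
      show "\<mu> * (norm (x - w))\<^sup>2 \<le> bergman_separation x w" if "w \<in> ?T - {x}" for w
        using that x S_e[of m] in_e by (intro t(3)) blast+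
    qed (use S(1) SX[of m] x \<mu>1 in auto)
    moreover have "c * (\<mu> ^ m * (\<Prod>w\<in>?T - {x}. norm (x - w))\<^sup>2)
        \<le> Re (l x x) * (\<mu> ^ m * (\<Prod>w\<in>?T - {x}. norm (x - w))\<^sup>2)"
      using in_e[of x] S_e[of m] x \<mu>1 by (intro mult_right_mono) auto
    ultimately show ?thesis by (simp add: mult.assoc)
  qed
  define G where "G = (\<lambda>m. sqrt (K.gap (S m) p))"
  have G_ge: "sqrt c * sqrt \<mu> ^ m * (\<Prod>w\<in>S m. norm (p - w)) \<le> G m" for m
  proof -
    have "c * \<mu> ^ m * (\<Prod>w\<in>S m. norm (p - w))\<^sup>2 \<le> K.gap (S m) p"
      using gap[of p m] pS[of m] by simp
    then have "sqrt (c * \<mu> ^ m * (\<Prod>w\<in>S m. norm (p - w))\<^sup>2) \<le> G m"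
      unfolding G_def by (rule real_sqrt_le_mono)
    moreover have "0 \<le> (\<Prod>w\<in>S m. norm (p - w))" by (intro prod_nonneg) auto
    ultimately show ?thesis by (simp add: real_sqrt_mult real_sqrt_power)
  qed
  have G0: "0 < G m" for m
  proof -
    have "0 < sqrt c * sqrt \<mu> ^ m * (\<Prod>w\<in>S m. norm (p - w))"
      using c \<mu>1 pS[of m] by (intro mult_pos_pos prod_pos) auto
    then show ?thesis using G_ge[of m] by simp
  qed
  have G2: "(G m)\<^sup>2 = K.gap (S m) p" for m
    using G0[of m] by (simp add: G_def)
  (* The unit vectors with zeros S m; their value at p is G m. *)
  define h where "h = (\<lambda>m y. K.vanishing_kernel (S m) p y / of_real (G m))"
  note SX' = S(1) subset_trans[OF subset_insertI SX] pX
  have sphere: "y \<in> cball 0 R" "y \<in> ?X" if "y \<in> cball p \<rho>" for y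
  proof -
    have "norm y \<le> norm p + \<rho>"
      using that norm_triangle_ineq[of p "y - p"] by (simp add: dist_norm norm_minus_commute)
    then show "y \<in> cball 0 R" "y \<in> ?X" using ps s \<rho> by (auto simp: R_def)
  qed
  define A where "A = max 1 (2 / \<beta>)"
  define B where "B = max 1 (M / sqrt c)"
  have "sqrt \<mu> * (\<rho> - e) \<le> 1"
  proof (rule growth_at_centre_le_one[where h = h and S = S and U = ?X and c = "sqrt c" and A = A and B = B])
    show "e < \<rho>" "0 < \<rho>" using e \<rho>'0 \<rho>' by auto
    show "cball p \<rho> \<subseteq> ?X" using sphere by blast
    show "h m holomorphic_on ?X" for m
    proof -
      obtain a where a: "K.vanishing_kernel (S m) p = (\<lambda>t. \<Sum>x\<in>insert p (S m). a x * K.kfun x t)"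
        using K.vanishing_kernel_kspan[OF SX'] by (auto simp: K.kspan_def)
      have "(\<lambda>t. \<Sum>x\<in>insert p (S m). a x * l t x / of_real (G m)) holomorphic_on ?X"
        using SX[of m] G0[of m] by (intro holomorphic_intros hol1) auto
      then show ?thesis
        by (rule holomorphic_transform) (simp add: h_def a K.kfun_eval sum_divide_distrib)
    qed
    show "S m \<subseteq> ball p e - {p}" for m using S_e[of m] pS[of m] by auto
    show "h m w = 0" if "w \<in> S m" for m w
      using that K.vanishing_kernel_zero[OF SX'] by (simp add: h_def)
    (* Every h m is a unit vector, so its value at y is at most the norm of evaluation at y. *)
    show "\<exists>N. \<forall>m. norm (h m y) \<le> N" if "y \<in> sphere p \<rho>" for y
    proof (intro exI allI)
      fix m
      have y: "y \<in> ?X" using that sphere by auto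
      have "(norm (K.vanishing_kernel (S m) p y))\<^sup>2 \<le> (G m)\<^sup>2 * Re (l y y)"
        using K.norm_eval_le[OF K.vanishing_kernel_mem[OF SX'] y] by (simp add: G2 K.gap_def)
      then have "(norm (h m y))\<^sup>2 \<le> Re (l y y)"
        using G0[of m] by (simp add: h_def norm_divide power_divide field_simps)
      then show "norm (h m y) \<le> sqrt (Re (l y y))" by (rule real_le_rsqrt)
    qed
    (* Here \<mu> \<ge> 1 is used to drop the powers of \<mu> from the lower bounds for the gaps. *)
    show "norm (h m y) \<le> B * A ^ m" if "y \<in> sphere p \<rho>" for m y
    proof -
      let ?T = "insert p (S m)"
      have y: "y \<in> ?X" "y \<in> cball 0 R" using that sphere by auto
      have T: "?T - {p} = S m" using pS[of m] by auto
      have "norm (K.vanishing_kernel (?T - {p}) p y) * (sqrt c * \<beta> ^ m)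
          \<le> real (card ?T) * M * sqrt (K.gap (?T - {p}) p)"
      proof (rule K.vanishing_kernel_bound)
        show "norm (l y x) \<le> M" if "x \<in> ?T" for x
          using that S_e[of m] in_e y(2) by (intro M) blast+
        show "0 < sqrt c * \<beta> ^ m" using c \<beta> by simp
        fix x assume x: "x \<in> ?T"
        have "(\<beta> ^ m)\<^sup>2 \<le> (\<Prod>w\<in>?T - {x}. norm (x - w))\<^sup>2"
          using S(4)[OF x] \<beta> by (intro power_mono) auto
        then have "c * 1 * (\<beta> ^ m)\<^sup>2 \<le> c * \<mu> ^ m * (\<Prod>w\<in>?T - {x}. norm (x - w))\<^sup>2"
          using c \<mu>1 by (intro mult_mono one_le_power) auto
        also have "\<dots> \<le> K.gap (?T - {x}) x" by (rule gap[OF x])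
        finally show "(sqrt c * \<beta> ^ m)\<^sup>2 \<le> K.gap (?T - {x}) x"
          using c by (simp add: power_mult_distrib)
      qed (use S(1) SX[of m] y in auto)
      then have "norm (K.vanishing_kernel (S m) p y) * (sqrt c * \<beta> ^ m) \<le> real (card ?T) * M * G m"
        unfolding T G_def .
      moreover have "real (card ?T) \<le> 2 ^ m"
        using S(1,2)[of m] pS[of m] of_nat_mono[OF Suc_leI[OF less_exp], of m] by simp
      then have "real (card ?T) * M * G m \<le> 2 ^ m * M * G m"
        using M0 G0[of m] by (intro mult_right_mono) auto
      ultimately have "norm (K.vanishing_kernel (S m) p y) * (sqrt c * \<beta> ^ m) \<le> 2 ^ m * M * G m"
        by simp
      then have "norm (h m y) \<le> M / sqrt c * (2 / \<beta>) ^ m"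
        using c \<beta> G0[of m] by (simp add: h_def norm_divide power_divide field_simps)
      also have "\<dots> \<le> B * A ^ m"
        using M0 c \<beta> unfolding A_def B_def by (intro mult_mono power_mono) auto
      finally show ?thesis .
    qed
    show "sqrt c * (sqrt \<mu> * (\<rho> - e)) ^ m * (\<Prod>w\<in>S m. norm (p - w)) \<le> norm (h m p) * (\<rho> - e) ^ m" for m
    proof -
      have "h m p = of_real (G m)"
        using K.vanishing_kernel_diag[OF SX', of m] G2[of m] G0[of m]
        by (simp add: h_def power2_eq_square flip: G2)
      then have "norm (h m p) = G m" using G0[of m] by simp
      then show ?thesis
        using mult_right_mono[OF G_ge[of m], of "(\<rho> - e) ^ m"] e \<rho>'0
        by (simp add: power_mult_distrib mult_ac)
    qed
    show "0 < sqrt \<mu> * (\<rho> - e)" using \<mu>1 e \<rho>'0 by simp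
  qed (use S c in \<open>auto simp: A_def B_def\<close>)
  moreover have "1 < sqrt \<mu> * \<rho>'"
  proof -
    have "sqrt 1 < sqrt (\<mu> * \<rho>'\<^sup>2)" using \<mu>\<rho> by (simp only: real_sqrt_less_iff)
    then show ?thesis using \<rho>'0 by (simp add: real_sqrt_mult)
  qed
  moreover have "sqrt \<mu> * \<rho>' \<le> sqrt \<mu> * (\<rho> - e)" using e \<mu>1 by (intro mult_left_mono) auto
  ultimately show False by simp
qed

end
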